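(* Let $k\in\mathbb Z$. (1) $\mathrm{Imm}^k_a(S^1,\mathbb R^2)$ is a smooth strong deformation retract of $\mathrm{Imm}^k(S^1,\mathbb R^2)$. (2) If $k\neq0$, the circle $\{e_\alpha:\alpha\in S^1\}$, where $e_\alpha(\theta)=\alpha e^{ik\theta}/(ik)$, is a smooth strong deformation retract of $\mathrm{Imm}^k_a(S^1,\mathbb R^2)$. (3) If $k\ne0$, the space $B^k_i(S^1,\mathbb R^2):=\mathrm{Imm}^k(S^1,\mathbb R^2)/\mathrm{Diff}^+(S^1)$ is contractible.
   Context: $S^1=\mathbb R/2\pi\mathbb Z$ (curves viewed as $2\pi$-periodic maps $\mathbb R\to\mathbb R^2\cong\mathbb C$). $\mathrm{Imm}(S^1,\mathbb R^2)$ is the Fréchet manifold of smooth immersions $S^1\to\mathbb R^2$. The degree of an immersion $c$ is the winding number of $c':S^1\to\mathbb R^2\setminus\{0\}$ around $0$; $\mathrm{Imm}^k(S^1,\mathbb R^2)$ is the open submanifold of immersions of degree $k$, and $\mathrm{Imm}^k_a(S^1,\mathbb R^2)$ the subset of those with constant speed ($|c'|$ constant). $\mathrm{Diff}^+(S^1)$ is the group of orientation-preserving smooth diffeomorphisms of $S^1$, acting by $c\mapsto c\circ\varphi$. *)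

theory Defs
  imports "HOL-Complex_Analysis.Complex_Analysis"
begin

text \<open>Curves S^1 -> R^2 = C are 2pi-periodic maps real => complex.\<close>

definition D :: "(real \<Rightarrow> 'a::real_normed_vector) \<Rightarrow> real \<Rightarrow> 'a" where
  "D c = (\<lambda>\<theta>. vector_derivative c (at \<theta>))"

definition smooth_fun :: "(real \<Rightarrow> 'a::real_normed_vector) \<Rightarrow> bool" where
  "smooth_fun c \<longleftrightarrow> (\<forall>j \<theta>. ((D ^^ j) c) differentiable (at \<theta>))"

definition periodic2pi :: "(real \<Rightarrow> 'a) \<Rightarrow> bool" where
  "periodic2pi c \<longleftrightarrow> (\<forall>\<theta>. c (\<theta> + 2 * pi) = c \<theta>)"

definition Imm :: "(real \<Rightarrow> complex) set" where
  "Imm = {c. periodic2pi c \<and> smooth_fun c \<and> (\<forall>\<theta>. D c \<theta> \<noteq> 0)}"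

definition imm_degree :: "(real \<Rightarrow> complex) \<Rightarrow> complex" where
  "imm_degree c = winding_number (\<lambda>t. D c (2 * pi * t)) 0"

definition Imm_k :: "int \<Rightarrow> (real \<Rightarrow> complex) set" where
  "Imm_k k = {c \<in> Imm. imm_degree c = of_int k}"

definition Imm_a :: "int \<Rightarrow> (real \<Rightarrow> complex) set" where
  "Imm_a k = {c \<in> Imm_k k. \<exists>r. \<forall>\<theta>. norm (D c \<theta>) = r}"

definition e_curve :: "int \<Rightarrow> complex \<Rightarrow> real \<Rightarrow> complex" where
  "e_curve k \<alpha> = (\<lambda>\<theta>. \<alpha> * exp (\<i> * of_int k * of_real \<theta>) / (\<i> * of_int k))"

definition e_circle :: "int \<Rightarrow> (real \<Rightarrow> complex) set" where
  "e_circle k = {e_curve k \<alpha> | \<alpha>. norm \<alpha> = 1}"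

definition pd_s :: "(real \<Rightarrow> real \<Rightarrow> complex) \<Rightarrow> real \<Rightarrow> real \<Rightarrow> complex" where
  "pd_s F = (\<lambda>s \<theta>. vector_derivative (\<lambda>s'. F s' \<theta>) (at s))"

definition pd_t :: "(real \<Rightarrow> real \<Rightarrow> complex) \<Rightarrow> real \<Rightarrow> real \<Rightarrow> complex" where
  "pd_t F = (\<lambda>s \<theta>. vector_derivative (F s) (at \<theta>))"

fun pds :: "bool list \<Rightarrow> (real \<Rightarrow> real \<Rightarrow> complex) \<Rightarrow> real \<Rightarrow> real \<Rightarrow> complex" where
  "pds [] F = F"
| "pds (b # bs) F = (if b then pd_s else pd_t) (pds bs F)"

definition smooth2 :: "(real \<Rightarrow> real \<Rightarrow> complex) \<Rightarrow> bool" where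
  "smooth2 F \<longleftrightarrow> (\<forall>bs. continuous_on UNIV (\<lambda>(s, \<theta>). pds bs F s \<theta>) \<and>
      (\<forall>s \<theta>. (\<lambda>s'. pds bs F s' \<theta>) differentiable (at s) \<and> (pds bs F s) differentiable (at \<theta>)))"

text \<open>Smooth curves in a set of loops (convenient calculus / exponential law).\<close>
definition smooth_curve_in :: "(real \<Rightarrow> complex) set \<Rightarrow> (real \<Rightarrow> real \<Rightarrow> complex) \<Rightarrow> bool" where
  "smooth_curve_in X F \<longleftrightarrow> smooth2 F \<and> (\<forall>s. F s \<in> X)"

text \<open>A map H : [0,1] x X -> curves is smooth iff it maps smooth curves to smooth curves.\<close>
definition smooth_homotopy ::
  "(real \<Rightarrow> complex) set \<Rightarrow> (real \<Rightarrow> (real \<Rightarrow> complex) \<Rightarrow> (real \<Rightarrow> complex)) \<Rightarrow> bool" where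
  "smooth_homotopy X H \<longleftrightarrow>
     (\<forall>t F. smooth_fun t \<and> (\<forall>s. t s \<in> {0..1}) \<and> smooth_curve_in X F
        \<longrightarrow> smooth2 (\<lambda>s. H (t s) (F s)))"

definition smooth_sdr :: "(real \<Rightarrow> complex) set \<Rightarrow> (real \<Rightarrow> complex) set \<Rightarrow> bool" where
  "smooth_sdr A X \<longleftrightarrow> A \<subseteq> X \<and>
     (\<exists>H. smooth_homotopy X H \<and>
        (\<forall>t\<in>{0..1}. \<forall>c\<in>X. H t c \<in> X) \<and>
        (\<forall>c\<in>X. H 0 c = c \<and> H 1 c \<in> A) \<and>
        (\<forall>t\<in>{0..1}. \<forall>a\<in>A. H t a = a))"

definition Cinf_open :: "int \<Rightarrow> (real \<Rightarrow> complex) set \<Rightarrow> bool" where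
  "Cinf_open k U \<longleftrightarrow> U \<subseteq> Imm_k k \<and>
     (\<forall>c\<in>U. \<exists>n. \<exists>\<epsilon>>0. {d \<in> Imm_k k. \<forall>j\<le>n. \<forall>\<theta>. norm ((D ^^ j) d \<theta> - (D ^^ j) c \<theta>) < \<epsilon>} \<subseteq> U)"

definition imm_top :: "int \<Rightarrow> (real \<Rightarrow> complex) topology" where
  "imm_top k = topology (Cinf_open k)"

text \<open>Orientation-preserving diffeomorphisms of S^1, via their lifts to R.\<close>
definition Diff_plus :: "(real \<Rightarrow> real) set" where
  "Diff_plus = {\<phi>. smooth_fun \<phi> \<and> (\<forall>\<theta>. D \<phi> \<theta> > 0) \<and> (\<forall>\<theta>. \<phi> (\<theta> + 2 * pi) = \<phi> \<theta> + 2 * pi)}"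

definition orbit :: "(real \<Rightarrow> complex) \<Rightarrow> (real \<Rightarrow> complex) set" where
  "orbit c = {c \<circ> \<phi> | \<phi>. \<phi> \<in> Diff_plus}"

definition B_k :: "int \<Rightarrow> (real \<Rightarrow> complex) set set" where
  "B_k k = orbit ` Imm_k k"

definition B_open :: "int \<Rightarrow> (real \<Rightarrow> complex) set set \<Rightarrow> bool" where
  "B_open k V \<longleftrightarrow> V \<subseteq> B_k k \<and> openin (imm_top k) {c \<in> Imm_k k. orbit c \<in> V}"

definition B_top :: "int \<Rightarrow> (real \<Rightarrow> complex) set topology" where
  "B_top k = topology (B_open k)"

lemma istopology_Cinf_open: "istopology (Cinf_open k)"
  unfolding istopology_def
proof (intro conjI allI impI)
  fix S T assume S: "Cinf_open k S" and T: "Cinf_open k T"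
  show "Cinf_open k (S \<inter> T)"
    unfolding Cinf_open_def
  proof (intro conjI ballI)
    show "S \<inter> T \<subseteq> Imm_k k" using S unfolding Cinf_open_def by blast
    fix c assume c: "c \<in> S \<inter> T"
    obtain n1 e1 where 1: "e1 > 0" "{d \<in> Imm_k k. \<forall>j\<le>n1. \<forall>\<theta>. norm ((D ^^ j) d \<theta> - (D ^^ j) c \<theta>) < e1} \<subseteq> S"
      using S c unfolding Cinf_open_def by blast
    obtain n2 e2 where 2: "e2 > 0" "{d \<in> Imm_k k. \<forall>j\<le>n2. \<forall>\<theta>. norm ((D ^^ j) d \<theta> - (D ^^ j) c \<theta>) < e2} \<subseteq> T"
      using T c unfolding Cinf_open_def by blast
    show "\<exists>n. \<exists>\<epsilon>>0. {d \<in> Imm_k k. \<forall>j\<le>n. \<forall>\<theta>. norm ((D ^^ j) d \<theta> - (D ^^ j) c \<theta>) < \<epsilon>} \<subseteq> S \<inter> T"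
    proof (intro exI[of _ "max n1 n2"] exI[of _ "min e1 e2"] conjI subsetI)
      show "min e1 e2 > 0" using 1 2 by simp
      fix d assume "d \<in> {d \<in> Imm_k k. \<forall>j\<le>max n1 n2. \<forall>\<theta>. norm ((D ^^ j) d \<theta> - (D ^^ j) c \<theta>) < min e1 e2}"
      then have d: "d \<in> Imm_k k" "\<And>j \<theta>. j \<le> max n1 n2 \<Longrightarrow> norm ((D ^^ j) d \<theta> - (D ^^ j) c \<theta>) < min e1 e2" by auto
      have "d \<in> S"
        by (rule subsetD[OF 1(2)]) (use d in simp)
      moreover have "d \<in> T"
        by (rule subsetD[OF 2(2)]) (use d in simp)
      ultimately show "d \<in> S \<inter> T" by simp
    qed
  qed
next
  fix K assume "\<forall>S\<in>K. Cinf_open k S"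
  then show "Cinf_open k (\<Union>K)" unfolding Cinf_open_def
    by (smt (verit) Union_iff Union_least subset_trans Union_upper)
qed

lemma openin_imm_top: "openin (imm_top k) = Cinf_open k"
  unfolding imm_top_def using istopology_Cinf_open by (simp add: topology_inverse')

lemma istopology_B_open: "istopology (B_open k)"
  unfolding istopology_def
proof (intro conjI allI impI)
  fix S T :: "(real \<Rightarrow> complex) set set"
  assume a: "B_open k S" and b: "B_open k T"
  have e: "{c \<in> Imm_k k. orbit c \<in> S \<inter> T} = {c \<in> Imm_k k. orbit c \<in> S} \<inter> {c \<in> Imm_k k. orbit c \<in> T}" by blast
  show "B_open k (S \<inter> T)"
    using a b unfolding B_open_def e by (simp add: le_infI1 openin_Int)
next
  fix K :: "(real \<Rightarrow> complex) set set set"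
  assume a: "\<forall>S\<in>K. B_open k S"
  have e: "{c \<in> Imm_k k. orbit c \<in> \<Union>K} = (\<Union>S\<in>K. {c \<in> Imm_k k. orbit c \<in> S})" by blast
  show "B_open k (\<Union>K)"
    using a unfolding B_open_def e by (auto intro!: openin_clauses(3))
qed

lemma openin_B_top: "openin (B_top k) = B_open k"
  unfolding B_top_def using istopology_B_open by (simp add: topology_inverse')

end

theory Submission
  imports Defs
begin

text \<open>
  A curve is deformed to constant speed by \<open>c \<circ> ((1 - t) id + t \<sigma>\<^sup>-\<^sup>1)\<close>, where \<open>\<sigma>\<close> is
  its normalized arc length; this is (1). For \<open>k \<noteq> 0\<close>, move the tangent angle linearly to \<open>k \<sigma>\<close> plus its mean
  deviation. The resulting unit tangents \<open>u\<close> need not integrate to zero, but since \<open>u\<close> is not constant its mean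
  \<open>m\<close> satisfies \<open>|m| < 1\<close>, so \<open>u - m\<close> is a nowhere vanishing closed velocity field of
  the same degree. All ingredients are intrinsic with respect to arc length, so this
  flow commutes with reparametrizations: on constant speed curves, followed by reparametrization to
  constant speed, it gives (2), and it descends to the quotient by \<open>Diff\<^sup>+\<close>, where all round curves are one point,
  which gives (3).
\<close>

section \<open>Smooth families of curves\<close>

text \<open>Smoothness in (1) and (2) and continuity in (3) concern the same few formulas. These are
  assembled from operations (products, quotients, norm, exp, primitives, inverse functions,
  composition in \<open>\<theta>\<close>) under which \<open>smooth_fam\<close> is closed, so both
  kinds of regularity come from one calculus. Equivariance dictates the normalizations. A
  reparametrization may move the base point, so the tangent angle is compared with its mean over arc
  length and not with its value at 0, and all means are taken over arc length. The hypothesis that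
  \<open>k\<close> is nonzero keeps the flow among immersions: for \<open>k = 0\<close> the unit
  tangent at \<open>t = 1\<close> would be constant and \<open>u - m\<close> would vanish
  identically. In (3) the homotopy is known upstairs and has to be continuous in time and orbit
  jointly. It descends because the product of a quotient map with the identity of the locally
  compact Hausdorff space [0, 1] is again a quotient map.\<close>

text \<open>A family \<^term>\<open>f p s \<theta>\<close> depends continuously on a point \<open>p\<close> of a topological space and smoothly on
  \<open>(s, \<theta>)\<close>. With a one-point space this is the smoothness of \<^const>\<open>smooth2\<close>; with
  parameter space \<open>[0, 1] \<times> Imm\<^sup>k\<close> and no dependence on \<open>s\<close> it yields continuity for
  the \<open>C\<^sup>\<infinity>\<close> topology.\<close>

definition jcont :: "'p topology \<Rightarrow> ('p \<Rightarrow> real \<Rightarrow> real \<Rightarrow> 'a::real_normed_vector) \<Rightarrow> bool" where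
  "jcont P f \<longleftrightarrow> continuous_map (prod_topology P euclidean) euclidean (\<lambda>(p, x). f p (fst x) (snd x))"

definition partials :: "'p topology \<Rightarrow> ('p \<Rightarrow> real \<Rightarrow> real \<Rightarrow> 'a::real_normed_vector)
    \<Rightarrow> ('p \<Rightarrow> real \<Rightarrow> real \<Rightarrow> 'a) \<Rightarrow> ('p \<Rightarrow> real \<Rightarrow> real \<Rightarrow> 'a) \<Rightarrow> bool" where
  "partials P f fs ft \<longleftrightarrow> (\<forall>p\<in>topspace P. \<forall>s \<theta>.
     ((\<lambda>x. f p x \<theta>) has_vector_derivative fs p s \<theta>) (at s) \<and>
     (f p s has_vector_derivative ft p s \<theta>) (at \<theta>))"

text \<open>The partials are witnessed existentially and not computed by
  \<open>vector_derivative\<close>: a closure property then only has to exhibit a derivative formula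
  whose constituents are covered by induction on the order.\<close>

fun Cn :: "'p topology \<Rightarrow> nat \<Rightarrow> ('p \<Rightarrow> real \<Rightarrow> real \<Rightarrow> 'a::real_normed_vector) \<Rightarrow> bool" where
  "Cn P 0 f \<longleftrightarrow> jcont P f"
| "Cn P (Suc n) f \<longleftrightarrow> jcont P f \<and> (\<exists>fs ft. partials P f fs ft \<and> Cn P n fs \<and> Cn P n ft)"

definition smooth_fam :: "'p topology \<Rightarrow> ('p \<Rightarrow> real \<Rightarrow> real \<Rightarrow> 'a::real_normed_vector) \<Rightarrow> bool" where
  "smooth_fam P f \<longleftrightarrow> (\<forall>n. Cn P n f)"

section \<open>Joint continuity of families\<close>

lemma jcont_iff:
  "jcont P f \<longleftrightarrow> (\<forall>p0\<in>topspace P. \<forall>s0 \<theta>0. \<forall>e>0. \<exists>U d. openin P U \<and> p0 \<in> U \<and> d > 0 \<and>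
     (\<forall>p\<in>U. \<forall>s \<theta>. dist s s0 < d \<longrightarrow> dist \<theta> \<theta>0 < d \<longrightarrow> dist (f p s \<theta>) (f p0 s0 \<theta>0) < e))"
  (is "_ \<longleftrightarrow> ?R")
proof
  assume f: "jcont P f"
  show ?R
  proof (intro ballI allI impI)
    fix p0 s0 \<theta>0 and e :: real
    assume p0: "p0 \<in> topspace P" and e: "e > 0"
    let ?W = "{x \<in> topspace (prod_topology P euclidean). (\<lambda>(p, x). f p (fst x) (snd x)) x \<in> ball (f p0 s0 \<theta>0) e}"
    have "openin (prod_topology P euclidean) ?W"
      using f unfolding jcont_def by (rule openin_continuous_map_preimage) auto
    moreover have "(p0, (s0, \<theta>0)) \<in> ?W" using p0 e by simp
    ultimately have "\<exists>U V. openin P U \<and> openin euclidean V \<and> p0 \<in> U \<and> (s0, \<theta>0) \<in> V \<and> U \<times> V \<subseteq> ?W"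
      by (rule openin_prod_topology_alt[THEN iffD1, rule_format])
    then obtain U V where UV: "openin P U" "open V" "p0 \<in> U" "(s0, \<theta>0) \<in> V" "U \<times> V \<subseteq> ?W"
      by (elim exE conjE) (simp only: open_openin[symmetric])
    obtain A B where "open A" "open B" "(s0, \<theta>0) \<in> A \<times> B" "A \<times> B \<subseteq> V"
      using UV(2,4) by (rule open_prod_elim)
    then have AB: "open A" "open B" "s0 \<in> A" "\<theta>0 \<in> B" "A \<times> B \<subseteq> V" by auto
    obtain d1 where d1: "d1 > 0" "ball s0 d1 \<subseteq> A" using AB open_contains_ball by blast
    obtain d2 where d2: "d2 > 0" "ball \<theta>0 d2 \<subseteq> B" using AB open_contains_ball by blast
    show "\<exists>U d. openin P U \<and> p0 \<in> U \<and> d > 0 \<and>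
     (\<forall>p\<in>U. \<forall>s \<theta>. dist s s0 < d \<longrightarrow> dist \<theta> \<theta>0 < d \<longrightarrow> dist (f p s \<theta>) (f p0 s0 \<theta>0) < e)"
    proof (intro exI[of _ U] exI[of _ "min d1 d2"] conjI ballI allI impI)
      fix p s \<theta> assume "p \<in> U" "dist s s0 < min d1 d2" "dist \<theta> \<theta>0 < min d1 d2"
      then have "(p, (s, \<theta>)) \<in> U \<times> V" using d1 d2 AB by (auto simp: dist_commute subset_iff)
      then have "(p, (s, \<theta>)) \<in> ?W" using UV by blast
      then show "dist (f p s \<theta>) (f p0 s0 \<theta>0) < e" by (simp add: dist_commute)
    qed (use UV d1 d2 in auto)
  qed
next
  assume R: ?R
  show "jcont P f"
    unfolding jcont_def continuous_map_atin
  proof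
    fix x assume "x \<in> topspace (prod_topology P (euclidean :: (real \<times> real) topology))"
    then obtain p0 s0 \<theta>0 where x: "x = (p0, (s0, \<theta>0))" and p0: "p0 \<in> topspace P" by (cases x) auto
    show "limitin euclidean (\<lambda>(p, x). f p (fst x) (snd x)) (case x of (p, x) \<Rightarrow> f p (fst x) (snd x)) (atin (prod_topology P euclidean) x)"
      unfolding limitin_canonical_iff tendsto_iff
    proof (intro allI impI)
      fix e :: real assume "e > 0"
      then obtain U d where U: "openin P U" "p0 \<in> U" "d > 0"
        "\<And>p s \<theta>. p \<in> U \<Longrightarrow> dist s s0 < d \<Longrightarrow> dist \<theta> \<theta>0 < d \<Longrightarrow> dist (f p s \<theta>) (f p0 s0 \<theta>0) < e"
        using R p0 by meson
      have "openin (prod_topology P euclidean) (U \<times> (ball s0 d \<times> ball \<theta>0 d))"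
        using U by (simp add: openin_prod_Times_iff open_Times)
      then show "\<forall>\<^sub>F y in atin (prod_topology P euclidean) x.
        dist (case y of (p, x) \<Rightarrow> f p (fst x) (snd x)) (case x of (p, x) \<Rightarrow> f p (fst x) (snd x)) < e"
        unfolding eventually_atin using U
        by (intro disjI2 conjI exI[of _ "U \<times> (ball s0 d \<times> ball \<theta>0 d)"]) (auto simp: x dist_commute)
    qed
  qed
qed

text \<open>Tube lemma: compactness of \<open>{-R..R}\<close> turns the neighbourhoods of the points
  (p0, s0, theta) into one neighbourhood of (p0, s0). Integrals and sup norms of derivatives need
  this uniformity.\<close>

lemma jcont_uniform:
  assumes f: "jcont P f" and p0: "p0 \<in> topspace P" and e: "e > 0"
  obtains U d where "openin P U" "p0 \<in> U" "d > 0"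
    "\<And>p s \<theta>. p \<in> U \<Longrightarrow> dist s s0 < d \<Longrightarrow> \<bar>\<theta>\<bar> \<le> R \<Longrightarrow> dist (f p s \<theta>) (f p0 s0 \<theta>) < e"
proof -
  have "\<exists>U d. openin P U \<and> p0 \<in> U \<and> d > 0 \<and>
     (\<forall>p\<in>U. \<forall>s \<theta>. dist s s0 < d \<longrightarrow> dist \<theta> \<theta>0 < d \<longrightarrow> dist (f p s \<theta>) (f p0 s0 \<theta>0) < e/2)" for \<theta>0
    using f[unfolded jcont_iff, rule_format, OF p0 half_gt_zero[OF e]] .
  then obtain U d where U: "\<And>t. openin P (U t)" "\<And>t. p0 \<in> U t" "\<And>t. d t > 0"
    "\<And>t p s \<theta>. p \<in> U t \<Longrightarrow> dist s s0 < d t \<Longrightarrow> dist \<theta> t < d t \<Longrightarrow> dist (f p s \<theta>) (f p0 s0 t) < e/2"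
    by metis
  have cp: "compact {-R..R}" by simp
  have cov: "{-R..R} \<subseteq> (\<Union>t\<in>{-R..R}. ball t (d t))" using U(3) by (auto intro: bexI)
  obtain T where T: "finite T" "{-R..R} \<subseteq> (\<Union>t\<in>T. ball t (d t))"
    using compactE_image[OF cp _ cov] by (metis open_ball)
  \<comment> \<open>The factor \<open>topspace P\<close> and the inserted \<open>1\<close> take care
    of an empty subcover, which can occur when \<open>R < 0\<close>.\<close>
  let ?U = "topspace P \<inter> (\<Inter>t\<in>T. U t)" and ?d = "Min (insert 1 (d ` T))"
  show thesis
  proof
    show "openin P ?U"
    proof (cases "T = {}")
      case False
      then have "openin P (\<Inter>t\<in>T. U t)" using T U by (intro openin_INT2) auto
      then show ?thesis by blast
    qed simp
    show "p0 \<in> ?U" using U p0 by auto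
    show "?d > 0" using T U by (subst Min_gr_iff) auto
    fix p s \<theta> assume *: "p \<in> ?U" "dist s s0 < ?d" "\<bar>\<theta>\<bar> \<le> R"
    then have "\<theta> \<in> {-R..R}" by auto
    then obtain t where t: "t \<in> T" "dist \<theta> t < d t" using T by (auto simp: dist_commute subset_iff)
    have "?d \<le> d t" using t T by (intro Min_le) auto
    then have "dist (f p s \<theta>) (f p0 s0 t) < e/2" using U(4)[of p t s \<theta>] * t by auto
    moreover have "dist (f p0 s0 \<theta>) (f p0 s0 t) < e/2" using U(4)[of p0 t s0 \<theta>] U t by auto
    ultimately show "dist (f p s \<theta>) (f p0 s0 \<theta>) < e"
      by (rule dist_triangle_half_l)
  qed
qed

lemma jcont_compose2:
  assumes "jcont P f" "jcont P g" and h: "continuous_on UNIV (\<lambda>(x, y). h x y)"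
  shows "jcont P (\<lambda>p s \<theta>. h (f p s \<theta>) (g p s \<theta>))"
proof -
  let ?X = "prod_topology P (euclidean :: (real \<times> real) topology)"
  have "continuous_map ?X (prod_topology euclidean euclidean)
     (\<lambda>x. ((\<lambda>(p, x). f p (fst x) (snd x)) x, (\<lambda>(p, x). g p (fst x) (snd x)) x))"
    using assms unfolding jcont_def by (intro continuous_map_pairedI)
  then have "continuous_map ?X euclidean
     ((\<lambda>(x, y). h x y) \<circ> (\<lambda>x. ((\<lambda>(p, x). f p (fst x) (snd x)) x, (\<lambda>(p, x). g p (fst x) (snd x)) x)))"
    using h by (intro continuous_map_compose) (auto simp: euclidean_product_topology)
  then show ?thesis unfolding jcont_def by (simp add: o_def case_prod_unfold)
qed

lemma jcont_compose1:
  assumes f: "jcont P f" and h: "continuous_on S h" and S: "\<And>p s \<theta>. p \<in> topspace P \<Longrightarrow> f p s \<theta> \<in> S"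
  shows "jcont P (\<lambda>p s \<theta>. h (f p s \<theta>))"
proof -
  have "continuous_map (prod_topology P (euclidean :: (real \<times> real) topology)) (top_of_set S)
      (\<lambda>(p, x). f p (fst x) (snd x))"
    using f S unfolding jcont_def by (auto simp: continuous_map_in_subtopology)
  then have "continuous_map (prod_topology P (euclidean :: (real \<times> real) topology)) euclidean
      (h \<circ> (\<lambda>(p, x). f p (fst x) (snd x)))"
    using h by (intro continuous_map_compose) auto
  then show ?thesis unfolding jcont_def by (simp add: o_def case_prod_unfold)
qed

lemma jcont_param: "continuous_map P euclidean a \<Longrightarrow> jcont P (\<lambda>p s \<theta>. a p)"
  unfolding jcont_def case_prod_unfold
  using continuous_map_compose[OF continuous_map_fst, of P euclidean a] by (simp add: o_def)

lemma jcont_real2: "continuous_on UNIV (\<lambda>x. h (fst x) (snd x)) \<Longrightarrow> jcont P (\<lambda>p s \<theta>. h s \<theta>)"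
  unfolding jcont_def case_prod_unfold
  using continuous_map_compose[OF continuous_map_snd, of euclidean euclidean "\<lambda>x. h (fst x) (snd x)" P]
  by (simp add: o_def)

lemma jcont_reparam:
  assumes f: "jcont P f" and b: "jcont P b"
  shows "jcont P (\<lambda>p s \<theta>. f p s (b p s \<theta>))"
proof -
  let ?X = "prod_topology P (euclidean :: (real \<times> real) topology)"
  have "continuous_map ?X (prod_topology P (prod_topology euclidean euclidean))
    (\<lambda>x. (fst x, (fst (snd x), (\<lambda>(p, x). b p (fst x) (snd x)) x)))"
  proof (intro continuous_map_pairedI)
    show "continuous_map ?X euclidean (\<lambda>x. fst (snd x))"
      using jcont_real2[of "\<lambda>s \<theta>. s" P] by (simp add: jcont_def case_prod_unfold continuous_on_fst)
  qed (use b in \<open>auto simp: jcont_def continuous_map_fst\<close>)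
  then have "continuous_map ?X euclidean ((\<lambda>(p, x). f p (fst x) (snd x)) \<circ> 
     (\<lambda>x. (fst x, (fst (snd x), (\<lambda>(p, x). b p (fst x) (snd x)) x))))"
    using f unfolding jcont_def
    by (intro continuous_map_compose) (auto simp: euclidean_product_topology)
  then show ?thesis unfolding jcont_def by (simp add: o_def case_prod_unfold)
qed

section \<open>Closure of \<open>Cn\<close> under algebraic operations and the chain rule\<close>

lemma Cn_jcont: "Cn P n f \<Longrightarrow> jcont P f"
  by (cases n) auto

lemma Cn_SucD: "Cn P (Suc n) f \<Longrightarrow> Cn P n f"
proof (induction n arbitrary: f)
  case (Suc n) then show ?case unfolding Cn.simps by meson
qed simp

lemma Cn_SucI: "jcont P f \<Longrightarrow> partials P f fs ft \<Longrightarrow> Cn P n fs \<Longrightarrow> Cn P n ft \<Longrightarrow> Cn P (Suc n) f"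
  by auto

lemma Cn_SucE:
  assumes "Cn P (Suc n) f"
  obtains fs ft where "jcont P f" "partials P f fs ft" "Cn P n fs" "Cn P n ft" "Cn P n f"
  using assms Cn_SucD[OF assms] by auto

lemma partials_I:
  "(\<And>p s \<theta>. p \<in> topspace P \<Longrightarrow> ((\<lambda>x. f p x \<theta>) has_vector_derivative fs p s \<theta>) (at s)) \<Longrightarrow>
   (\<And>p s \<theta>. p \<in> topspace P \<Longrightarrow> ((\<lambda>x. f p s x) has_vector_derivative ft p s \<theta>) (at \<theta>)) \<Longrightarrow> partials P f fs ft"
  unfolding partials_def by auto

lemma partials_D1: "partials P f fs ft \<Longrightarrow> p \<in> topspace P \<Longrightarrow> ((\<lambda>x. f p x \<theta>) has_vector_derivative fs p s \<theta>) (at s)"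
  and partials_D2: "partials P f fs ft \<Longrightarrow> p \<in> topspace P \<Longrightarrow> ((\<lambda>x. f p s x) has_vector_derivative ft p s \<theta>) (at \<theta>)"
  unfolding partials_def by auto

lemma jcont_cong:
  assumes "jcont P f" "\<And>p. p \<in> topspace P \<Longrightarrow> f p = g p"
  shows "jcont P g"
  using assms(1) unfolding jcont_def by (rule continuous_map_eq) (use assms(2) in auto)

lemma partials_cong:
  assumes "partials P f fs ft" "\<And>p. p \<in> topspace P \<Longrightarrow> f p = g p"
  shows "partials P g fs ft"
  using assms unfolding partials_def by auto

lemma Cn_cong:
  assumes "Cn P n f" "\<And>p. p \<in> topspace P \<Longrightarrow> f p = g p"
  shows "Cn P n g"
proof (cases n)
  case 0
  then show ?thesis using jcont_cong[OF _ assms(2)] assms(1) by simp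
next
  case (Suc m)
  from assms(1)[unfolded Suc] obtain fs ft where "jcont P f" "partials P f fs ft" "Cn P m fs" "Cn P m ft"
    by (elim Cn_SucE)
  then have "jcont P g" "partials P g fs ft" "Cn P m fs" "Cn P m ft"
    using jcont_cong[of P f g] partials_cong[of P f fs ft g] assms(2) by blast+
  then show ?thesis unfolding Suc by (rule Cn_SucI)
qed

lemma Cn_param:
  fixes a :: "'p \<Rightarrow> 'a::real_normed_vector"
  shows "continuous_map P euclidean a \<Longrightarrow> Cn P n (\<lambda>p s \<theta>. a p)"
proof (induction n arbitrary: a)
  case 0 then show ?case by (simp add: jcont_param)
next
  case (Suc n)
  have "Cn P n (\<lambda>p s \<theta>. 0 :: 'a)" by (rule Suc.IH) simp
  moreover have "partials P (\<lambda>p s \<theta>. a p) (\<lambda>p s \<theta>. 0) (\<lambda>p s \<theta>. 0)"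
    by (simp add: partials_def)
  ultimately show ?case using jcont_param[OF Suc.prems] by (intro Cn_SucI)
qed

lemma Cn_const: "Cn P n (\<lambda>p s \<theta>. a)"
  by (rule Cn_param) simp

lemma Cn_theta: "Cn P n (\<lambda>p s \<theta>. \<theta>)"
proof -
  have j: "jcont P (\<lambda>p s \<theta>. \<theta>)" by (rule jcont_real2) (intro continuous_intros)
  show ?thesis
  proof (cases n)
    case (Suc m)
    have "partials P (\<lambda>p s \<theta>. \<theta>) (\<lambda>p s \<theta>. 0) (\<lambda>p s \<theta>. 1)"
      by (simp add: partials_def has_vector_derivative_id)
    with j show ?thesis unfolding Suc by (rule Cn_SucI) (rule Cn_const)+
  qed (use j in simp)
qed

lemma Cn_s: "Cn P n (\<lambda>p s \<theta>. s)"
proof -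
  have j: "jcont P (\<lambda>p s \<theta>. s)" by (rule jcont_real2) (intro continuous_intros)
  show ?thesis
  proof (cases n)
    case (Suc m)
    have "partials P (\<lambda>p s \<theta>. s) (\<lambda>p s \<theta>. 1) (\<lambda>p s \<theta>. 0)"
      by (simp add: partials_def has_vector_derivative_id)
    with j show ?thesis unfolding Suc by (rule Cn_SucI) (rule Cn_const)+
  qed (use j in simp)
qed

lemma Cn_linear:
  assumes h: "bounded_linear h"
  shows "Cn P n f \<Longrightarrow> Cn P n (\<lambda>p s \<theta>. h (f p s \<theta>))"
proof (induction n arbitrary: f)
  case 0
  then show ?case unfolding Cn.simps by (rule jcont_compose1[OF _ linear_continuous_on[OF h]]) auto
next
  case (Suc n)
  from Suc.prems obtain fs ft where *: "jcont P f" "partials P f fs ft" "Cn P n fs" "Cn P n ft"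
    by (elim Cn_SucE)
  have "jcont P (\<lambda>p s \<theta>. h (f p s \<theta>))"
    by (rule jcont_compose1[OF *(1) linear_continuous_on[OF h]]) auto
  moreover have "partials P (\<lambda>p s \<theta>. h (f p s \<theta>)) (\<lambda>p s \<theta>. h (fs p s \<theta>)) (\<lambda>p s \<theta>. h (ft p s \<theta>))"
    using *(2) by (auto simp: partials_def intro: bounded_linear.has_vector_derivative[OF h])
  ultimately show ?case by (rule Cn_SucI) (rule Suc.IH *)+
qed

lemma Cn_add:
  "Cn P n f \<Longrightarrow> Cn P n g \<Longrightarrow> Cn P n (\<lambda>p s \<theta>. f p s \<theta> + g p s \<theta>)"
proof (induction n arbitrary: f g)
  case 0
  then show ?case unfolding Cn.simps
    by (rule jcont_compose2) (simp add: case_prod_unfold, intro continuous_intros)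
next
  case (Suc n)
  from Suc.prems obtain fs ft where f: "jcont P f" "partials P f fs ft" "Cn P n fs" "Cn P n ft"
    by (elim Cn_SucE)
  from Suc.prems obtain gs gt where g: "jcont P g" "partials P g gs gt" "Cn P n gs" "Cn P n gt"
    by (elim Cn_SucE)
  have "jcont P (\<lambda>p s \<theta>. f p s \<theta> + g p s \<theta>)"
    by (rule jcont_compose2[OF f(1) g(1)]) (simp add: case_prod_unfold, intro continuous_intros)
  moreover have "partials P (\<lambda>p s \<theta>. f p s \<theta> + g p s \<theta>)
      (\<lambda>p s \<theta>. fs p s \<theta> + gs p s \<theta>) (\<lambda>p s \<theta>. ft p s \<theta> + gt p s \<theta>)"
    using f(2) g(2) by (auto simp: partials_def intro: has_vector_derivative_add)
  ultimately show ?case by (rule Cn_SucI) (rule Suc.IH f g)+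
qed

text \<open>One Leibniz rule for products, scalar multiples and inner products. Its derivative
  contains \<open>f\<close> and \<open>g\<close> themselves, which is why \<open>Cn_SucE\<close>
  also delivers the lower order \<open>Cn P n f\<close>.\<close>

lemma Cn_bilinear:
  assumes h: "bounded_bilinear h"
  shows "Cn P n f \<Longrightarrow> Cn P n g \<Longrightarrow> Cn P n (\<lambda>p s \<theta>. h (f p s \<theta>) (g p s \<theta>))"
proof -
  have c: "continuous_on UNIV (\<lambda>(x, y). h x y)"
    unfolding case_prod_unfold by (intro bounded_bilinear.continuous_on[OF h] continuous_intros)
  show "Cn P n f \<Longrightarrow> Cn P n g \<Longrightarrow> Cn P n (\<lambda>p s \<theta>. h (f p s \<theta>) (g p s \<theta>))"
  proof (induction n arbitrary: f g)
    case 0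
    then show ?case unfolding Cn.simps by (rule jcont_compose2[OF _ _ c])
  next
    case (Suc n)
    from Suc.prems obtain fs ft where f: "jcont P f" "partials P f fs ft" "Cn P n fs" "Cn P n ft" "Cn P n f"
      by (elim Cn_SucE)
    from Suc.prems obtain gs gt where g: "jcont P g" "partials P g gs gt" "Cn P n gs" "Cn P n gt" "Cn P n g"
      by (elim Cn_SucE)
    have "partials P (\<lambda>p s \<theta>. h (f p s \<theta>) (g p s \<theta>))
        (\<lambda>p s \<theta>. h (f p s \<theta>) (gs p s \<theta>) + h (fs p s \<theta>) (g p s \<theta>))
        (\<lambda>p s \<theta>. h (f p s \<theta>) (gt p s \<theta>) + h (ft p s \<theta>) (g p s \<theta>))"
      using f(2) g(2) by (auto simp: partials_def intro: bounded_bilinear.has_vector_derivative[OF h])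
    with jcont_compose2[OF f(1) g(1) c] show ?case
      by (rule Cn_SucI) (rule Cn_add Suc.IH f g)+
  qed
qed

text \<open>The derivative reproduces \<open>exp f\<close> as a factor, so the induction hypothesis
  for the same \<open>f\<close> and closure under products suffice. \<open>Cn_inverse\<close> and
  \<open>Cn_norm\<close> bootstrap in the same way.\<close>

lemma Cn_exp:
  fixes f :: "'p \<Rightarrow> real \<Rightarrow> real \<Rightarrow> complex"
  shows "Cn P n f \<Longrightarrow> Cn P n (\<lambda>p s \<theta>. exp (f p s \<theta>))"
proof (induction n)
  case 0
  then show ?case unfolding Cn.simps
    by (rule jcont_compose1[of _ _ UNIV]) (auto intro: continuous_intros)
next
  case (Suc n)
  from Suc.prems obtain fs ft where f: "jcont P f" "partials P f fs ft" "Cn P n fs" "Cn P n ft" "Cn P n f"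
    by (elim Cn_SucE)
  have "jcont P (\<lambda>p s \<theta>. exp (f p s \<theta>))"
    by (rule jcont_compose1[OF f(1), of UNIV]) (auto intro: continuous_intros)
  moreover have "partials P (\<lambda>p s \<theta>. exp (f p s \<theta>))
      (\<lambda>p s \<theta>. fs p s \<theta> * exp (f p s \<theta>)) (\<lambda>p s \<theta>. ft p s \<theta> * exp (f p s \<theta>))"
    using f(2) by (auto simp: partials_def intro!: field_vector_diff_chain_at[OF _ DERIV_exp, unfolded o_def])
  ultimately show ?case
    by (rule Cn_SucI) (rule Cn_bilinear[OF bounded_bilinear_mult] Suc.IH f)+
qed

lemma Cn_inverse:
  fixes f :: "'p \<Rightarrow> real \<Rightarrow> real \<Rightarrow> 'a::real_normed_field"
  assumes nz: "\<And>p s \<theta>. p \<in> topspace P \<Longrightarrow> f p s \<theta> \<noteq> 0"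
  shows "Cn P n f \<Longrightarrow> Cn P n (\<lambda>p s \<theta>. inverse (f p s \<theta>))"
proof (induction n)
  case 0
  then show ?case unfolding Cn.simps
    by (rule jcont_compose1[of _ _ "-{0}"]) (use nz in \<open>auto intro: continuous_intros\<close>)
next
  case (Suc n)
  from Suc.prems obtain fs ft where f: "jcont P f" "partials P f fs ft" "Cn P n fs" "Cn P n ft" "Cn P n f"
    by (elim Cn_SucE)
  have j: "jcont P (\<lambda>p s \<theta>. inverse (f p s \<theta>))"
    by (rule jcont_compose1[OF f(1), of "-{0}"]) (use nz in \<open>auto intro: continuous_intros\<close>)
  have d: "(inverse has_field_derivative - (inverse x * inverse x)) (at x)" if "x \<noteq> 0" for x :: 'a
    using that by (auto intro!: derivative_eq_intros simp: power2_eq_square)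
  have "partials P (\<lambda>p s \<theta>. inverse (f p s \<theta>))
      (\<lambda>p s \<theta>. fs p s \<theta> * - (inverse (f p s \<theta>) * inverse (f p s \<theta>)))
      (\<lambda>p s \<theta>. ft p s \<theta> * - (inverse (f p s \<theta>) * inverse (f p s \<theta>)))"
    by (rule partials_I[OF field_vector_diff_chain_at[OF partials_D1[OF f(2)] d[OF nz], unfolded o_def]
          field_vector_diff_chain_at[OF partials_D2[OF f(2)] d[OF nz], unfolded o_def]])
  with j show ?case
    by (rule Cn_SucI) (rule Cn_bilinear[OF bounded_bilinear_mult] Suc.IH f
      Cn_linear[OF bounded_linear_minus[OF bounded_linear_ident]])+
qed

lemma Cn_norm:
  fixes f :: "'p \<Rightarrow> real \<Rightarrow> real \<Rightarrow> 'a::real_inner"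
  assumes nz: "\<And>p s \<theta>. p \<in> topspace P \<Longrightarrow> f p s \<theta> \<noteq> 0"
  shows "Cn P n f \<Longrightarrow> Cn P n (\<lambda>p s \<theta>. norm (f p s \<theta>))"
proof (induction n)
  case 0
  then show ?case unfolding Cn.simps
    by (rule jcont_compose1[of _ _ UNIV]) (auto intro: continuous_intros)
next
  case (Suc n)
  from Suc.prems obtain fs ft where f: "jcont P f" "partials P f fs ft" "Cn P n fs" "Cn P n ft" "Cn P n f"
    by (elim Cn_SucE)
  have g: "Cn P n (\<lambda>p s \<theta>. inverse (norm (f p s \<theta>)))"
    using nz by (intro Cn_inverse Suc.IH f) auto
  have d: "((\<lambda>x. norm (h x)) has_vector_derivative (h' \<bullet> h x) * inverse (norm (h x))) (at x)"
    if "(h has_vector_derivative h') (at x)" "h x \<noteq> 0" for h :: "real \<Rightarrow> 'a" and h' x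
  proof -
    have "((\<lambda>x. norm (h x)) has_derivative (\<lambda>t. (t *\<^sub>R h') \<bullet> sgn (h x))) (at x)"
      using diff_chain_at[OF that(1)[unfolded has_vector_derivative_def] has_derivative_norm[OF that(2)]]
      by (simp add: o_def)
    then show ?thesis unfolding has_vector_derivative_def
      by (simp add: sgn_div_norm algebra_simps)
  qed
  have "jcont P (\<lambda>p s \<theta>. norm (f p s \<theta>))"
    by (rule jcont_compose1[OF f(1), of UNIV]) (auto intro: continuous_intros)
  moreover have "partials P (\<lambda>p s \<theta>. norm (f p s \<theta>))
      (\<lambda>p s \<theta>. (fs p s \<theta> \<bullet> f p s \<theta>) * inverse (norm (f p s \<theta>)))
      (\<lambda>p s \<theta>. (ft p s \<theta> \<bullet> f p s \<theta>) * inverse (norm (f p s \<theta>)))"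
    by (rule partials_I[OF d[OF partials_D1[OF f(2)] nz] d[OF partials_D2[OF f(2)] nz]])
  ultimately show ?case
    by (rule Cn_SucI) (rule Cn_bilinear[OF bounded_bilinear_mult]
       Cn_bilinear[OF bounded_bilinear_inner] f g)+
qed

lemma jcont_slice2:
  assumes "jcont P f" "p \<in> topspace P"
  shows "continuous_on UNIV (\<lambda>x. f p (fst x) (snd x))"
proof -
  have "continuous_map euclidean (prod_topology P euclidean) (\<lambda>x :: real \<times> real. (p, x))"
    using assms(2) by (intro continuous_map_pairedI) auto
  from continuous_map_compose[OF this assms(1)[unfolded jcont_def]] show ?thesis by (simp add: o_def)
qed

lemma jcont_slice:
  assumes "jcont P f" "p \<in> topspace P"
  shows "continuous_on UNIV (f p s)"
  using continuous_on_compose2[OF jcont_slice2[OF assms], of UNIV "\<lambda>\<theta>. (s, \<theta>)"]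
  by (simp add: continuous_intros)

text \<open>Existence of both partial derivatives together with continuity of one of them, here
  \<open>ft\<close>, gives total differentiability.\<close>

lemma partials_has_derivative:
  assumes f: "partials P f fs ft" and ft: "jcont P ft" and p: "p \<in> topspace P"
  shows "((\<lambda>z. f p (fst z) (snd z)) has_derivative (\<lambda>t. fst t *\<^sub>R fs p s y + snd t *\<^sub>R ft p s y)) (at (s, y))"
proof -
  have "((\<lambda>(x, y). f p x y) has_derivative
     (\<lambda>(tx, ty). tx *\<^sub>R fs p s y + blinfun_apply (blinfun_scaleR_left (ft p s y)) ty))
     (at (s, y) within UNIV \<times> UNIV)"
  proof (rule has_derivative_partialsI[where fy = "\<lambda>x y. blinfun_scaleR_left (ft p x y)"])
    show "((\<lambda>x. f p x y) has_derivative (\<lambda>tx. tx *\<^sub>R fs p s y)) (at s)"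
      using partials_D1[OF f p] by (simp add: has_vector_derivative_def)
    show "(f p x has_derivative blinfun_apply (blinfun_scaleR_left (ft p x y))) (at y)" for x y
      using partials_D2[OF f p] by (simp add: has_vector_derivative_def)
    have "isCont (\<lambda>x. ft p (fst x) (snd x)) (s, y)"
      using jcont_slice2[OF ft p] by (simp add: continuous_on_eq_continuous_at)
    then have "isCont (\<lambda>x. blinfun_scaleR_left (ft p (fst x) (snd x))) (s, y)"
      by (rule isCont_o2) (intro linear_continuous_at bounded_linear_blinfun_scaleR_left)
    then show "continuous (at (s, y) within UNIV \<times> UNIV) (\<lambda>(x, y). blinfun_scaleR_left (ft p x y))"
      by (simp add: case_prod_unfold)
  qed auto
  then show ?thesis by (simp add: case_prod_unfold)
qed

text \<open>In the derivative along \<open>s\<close> the variable enters through two arguments of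
  \<open>f\<close> at once, so the total derivative of \<open>f p\<close> is composed with the curve
  x \<mapsto> (x, b p x theta).\<close>

lemma Cn_reparam:
  fixes f :: "'p \<Rightarrow> real \<Rightarrow> real \<Rightarrow> 'a::real_normed_vector"
  shows "Cn P n f \<Longrightarrow> Cn P n b \<Longrightarrow> Cn P n (\<lambda>p s \<theta>. f p s (b p s \<theta>))"
proof (induction n arbitrary: f)
  case 0
  then show ?case by (simp add: jcont_reparam)
next
  case (Suc n)
  from Suc.prems obtain fs ft where f: "jcont P f" "partials P f fs ft" "Cn P n fs" "Cn P n ft"
    by (elim Cn_SucE)
  from Suc.prems obtain bs bt where b: "jcont P b" "partials P b bs bt" "Cn P n bs" "Cn P n bt" "Cn P n b"
    by (elim Cn_SucE)
  have "((\<lambda>x. f p x (b p x \<theta>)) has_vector_derivative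
      (fs p s (b p s \<theta>) + bs p s \<theta> *\<^sub>R ft p s (b p s \<theta>))) (at s)" if p: "p \<in> topspace P" for p s \<theta>
  proof -
    have "((\<lambda>z. f p (fst z) (snd z)) has_derivative
       (\<lambda>t. fst t *\<^sub>R fs p s (b p s \<theta>) + snd t *\<^sub>R ft p s (b p s \<theta>))) (at (s, b p s \<theta>))"
      by (rule partials_has_derivative[OF f(2) Cn_jcont[OF f(4)] p])
    moreover have "((\<lambda>x. (x, b p x \<theta>)) has_derivative (\<lambda>t. (t, t *\<^sub>R bs p s \<theta>))) (at s)"
      using partials_D1[OF b(2) p] unfolding has_vector_derivative_def
      by (intro has_derivative_Pair has_derivative_ident)
    ultimately have "((\<lambda>z. f p (fst z) (snd z)) \<circ> (\<lambda>x. (x, b p x \<theta>)) has_derivative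
       (\<lambda>t. fst t *\<^sub>R fs p s (b p s \<theta>) + snd t *\<^sub>R ft p s (b p s \<theta>)) \<circ> (\<lambda>t. (t, t *\<^sub>R bs p s \<theta>))) (at s)"
      by (intro diff_chain_at) simp_all
    then show ?thesis unfolding has_vector_derivative_def by (simp add: o_def scaleR_add_right)
  qed
  moreover have "((\<lambda>x. f p s (b p s x)) has_vector_derivative (bt p s \<theta> *\<^sub>R ft p s (b p s \<theta>))) (at \<theta>)"
    if p: "p \<in> topspace P" for p s \<theta>
    using vector_diff_chain_at[OF partials_D2[OF b(2) p] partials_D2[OF f(2) p]] by (simp add: o_def)
  ultimately have "partials P (\<lambda>p s \<theta>. f p s (b p s \<theta>))
     (\<lambda>p s \<theta>. fs p s (b p s \<theta>) + bs p s \<theta> *\<^sub>R ft p s (b p s \<theta>)) (\<lambda>p s \<theta>. bt p s \<theta> *\<^sub>R ft p s (b p s \<theta>))"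
    by (rule partials_I)
  with jcont_reparam[OF f(1) b(1)] show ?case
    by (rule Cn_SucI)
      (intro Cn_add Cn_bilinear[OF bounded_bilinear_scaleR] Suc.IH b f)+
qed

text \<open>The primitive vanishing at \<open>0\<close>; the interval integral is oriented, so \<open>\<theta> < 0\<close> is allowed.\<close>

definition prim :: "(real \<Rightarrow> 'a::euclidean_space) \<Rightarrow> real \<Rightarrow> 'a" where
  "prim f \<theta> = (LBINT x=ereal 0..ereal \<theta>. f x)"

section \<open>Primitives depending on parameters\<close>

lemma prim_0 [simp]: "prim f 0 = 0"
  by (simp add: prim_def)

lemma prim_has_vector_derivative:
  assumes "continuous_on UNIV f"
  shows "(prim f has_vector_derivative f x) (at x)"
proof -
  \<comment> \<open>A closed interval with both 0 and \<open>x\<close> in its interior, so that the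
    one-sided notion in the fundamental theorem becomes a derivative at \<open>x\<close>.\<close>
  let ?a = "min 0 x - 1" and ?b = "max 0 x + 1"
  have "((\<lambda>u. LBINT y=ereal 0..ereal u. f y) has_vector_derivative f x) (at x within {?a..?b})"
    by (rule interval_integral_FTC2) (use assms in \<open>auto intro: continuous_on_subset\<close>)
  moreover have "at x within {?a..?b} = at x"
    by (rule at_within_interior) (auto simp: interior_atLeastAtMost_real)
  ultimately show ?thesis by (simp add: prim_def[abs_def])
qed

lemma eq_of_vector_derivative:
  fixes F G :: "real \<Rightarrow> 'a::real_normed_vector"
  assumes "\<And>x. (F has_vector_derivative f x) (at x)" "\<And>x. (G has_vector_derivative f x) (at x)"
    and "F a = G a"
  shows "F x = G x"
proof -
  have "((\<lambda>x. F x - G x) has_vector_derivative 0) (at x within UNIV)" for x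
    using has_vector_derivative_diff[OF assms(1) assms(2), of x] by simp
  from has_vector_derivative_zero_constant[OF convex_UNIV this] obtain c where "\<And>x. F x - G x = c" by auto
  then show ?thesis using assms(3) by (metis eq_iff_diff_eq_0)
qed

lemma prim_unique:
  fixes F :: "real \<Rightarrow> 'a::euclidean_space"
  assumes F: "\<And>x. (F has_vector_derivative f x) (at x)" and f: "continuous_on UNIV f"
  shows "prim f x = F x - F 0"
  using eq_of_vector_derivative[of "prim f" f "\<lambda>x. F x - F 0" 0 x] prim_has_vector_derivative[OF f]
    has_vector_derivative_diff[OF F has_vector_derivative_const]
  by simp

lemma prim_diff:
  assumes "continuous_on UNIV f" "continuous_on UNIV g"
  shows "prim (\<lambda>x. f x - g x) \<theta> = prim f \<theta> - prim g \<theta>"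
  by (subst prim_unique[of "\<lambda>x. prim f x - prim g x"])
    (use assms in \<open>auto intro!: derivative_eq_intros continuous_intros prim_has_vector_derivative\<close>)

lemma prim_scaleR:
  assumes "continuous_on UNIV f"
  shows "prim (\<lambda>x. c *\<^sub>R f x) \<theta> = c *\<^sub>R prim f \<theta>"
  by (subst prim_unique[of "\<lambda>x. c *\<^sub>R prim f x"])
    (use assms in \<open>auto intro!: derivative_eq_intros continuous_intros prim_has_vector_derivative\<close>)

lemma prim_bound:
  assumes f: "continuous_on UNIV f" and B: "\<And>x. \<bar>x\<bar> \<le> R \<Longrightarrow> norm (f x) \<le> B" and \<theta>: "\<bar>\<theta>\<bar> \<le> R"
  shows "norm (prim f \<theta>) \<le> B * R"
proof -
  have B0: "0 \<le> B" using B[of 0] \<theta> norm_ge_zero[of "f 0"] by linarith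
  have "norm (prim f \<theta> - prim f 0) \<le> B * norm (\<theta> - 0)"
  proof (rule differentiable_bound[of "{-R..R}" _ "\<lambda>x t. t *\<^sub>R f x"])
    show "(prim f has_derivative (\<lambda>t. t *\<^sub>R f x)) (at x within {- R..R})" for x
      using prim_has_vector_derivative[OF f, of x] unfolding has_vector_derivative_def
      by (rule has_derivative_at_withinI)
    show "onorm (\<lambda>t. t *\<^sub>R f x) \<le> B" if "x \<in> {-R..R}" for x
      using B[of x] that by (simp add: onorm_scaleR_left onorm_id abs_le_iff)
  qed (use \<theta> in auto)
  also have "\<dots> \<le> B * R" using \<theta> B0 by (simp add: mult_left_mono)
  finally show ?thesis by simp
qed

text \<open>The error splits into the change of the integrand at fixed upper limit, bounded
  uniformly on \<open>{-R..R}\<close>, and the change of the upper limit for the fixed integrand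
  \<open>f p0 s0\<close>.\<close>

lemma jcont_prim:
  assumes f: "jcont P f"
  shows "jcont P (\<lambda>p s \<theta>. prim (f p s) \<theta>)"
  unfolding jcont_iff
proof (intro ballI allI impI)
  fix p0 and s0 \<theta>0 e :: real
  assume p0: "p0 \<in> topspace P" and e: "e > 0"
  \<comment> \<open>The slack 1 matches the bound 1 in the radius chosen below, so all upper limits
    in play stay in \<open>{-R..R}\<close>.\<close>
  define R where "R = \<bar>\<theta>0\<bar> + 1"
  have R: "R > 0" by (simp add: R_def)
  obtain U d where U: "openin P U" "p0 \<in> U" "d > 0"
    "\<And>p s \<theta>. p \<in> U \<Longrightarrow> dist s s0 < d \<Longrightarrow> \<bar>\<theta>\<bar> \<le> R \<Longrightarrow> dist (f p s \<theta>) (f p0 s0 \<theta>) < e / (4 * R)"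
    using jcont_uniform[OF f p0, of "e / (4 * R)" s0 R] e R by auto
  have "isCont (prim (f p0 s0)) \<theta>0"
    using prim_has_vector_derivative[OF jcont_slice[OF f p0]] has_vector_derivative_continuous by blast
  then obtain d' where d': "d' > 0" "\<And>\<theta>. dist \<theta> \<theta>0 < d' \<Longrightarrow> dist (prim (f p0 s0) \<theta>) (prim (f p0 s0) \<theta>0) < e / 2"
    unfolding continuous_at_eps_delta using e by (meson half_gt_zero)
  show "\<exists>U d. openin P U \<and> p0 \<in> U \<and> d > 0 \<and>
     (\<forall>p\<in>U. \<forall>s \<theta>. dist s s0 < d \<longrightarrow> dist \<theta> \<theta>0 < d \<longrightarrow> dist (prim (f p s) \<theta>) (prim (f p0 s0) \<theta>0) < e)"
  proof (intro exI[of _ U] exI[of _ "min (min d d') 1"] conjI ballI allI impI)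
    fix p s \<theta> assume *: "p \<in> U" "dist s s0 < min (min d d') 1" "dist \<theta> \<theta>0 < min (min d d') 1"
    have p: "p \<in> topspace P" using U(1) *(1) openin_subset by blast
    have "\<bar>\<theta>\<bar> \<le> R" using * by (auto simp: R_def dist_real_def)
    have c: "continuous_on UNIV (\<lambda>x. f p s x - f p0 s0 x)"
      by (intro continuous_intros jcont_slice[OF f]) (use p p0 in auto)
    have "norm (prim (\<lambda>x. f p s x - f p0 s0 x) \<theta>) \<le> e / (4 * R) * R"
    proof (rule prim_bound[OF c])
      show "norm (f p s x - f p0 s0 x) \<le> e / (4 * R)" if "\<bar>x\<bar> \<le> R" for x
        using U(4)[of p s x] * that by (simp add: dist_norm)
    qed fact
    also have "\<dots> = e / 4" using R by simp
    finally have "dist (prim (f p s) \<theta>) (prim (f p0 s0) \<theta>) < e / 2"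
      using e by (subst (asm) prim_diff) (use p p0 in \<open>auto simp: dist_norm intro: jcont_slice[OF f]\<close>)
    moreover have "dist (prim (f p0 s0) \<theta>0) (prim (f p0 s0) \<theta>) < e / 2" using d'(2)[of \<theta>] * by (simp add: dist_commute)
    ultimately show "dist (prim (f p s) \<theta>) (prim (f p0 s0) \<theta>0) < e"
      by (metis dist_commute dist_triangle_half_r)
  qed (use U d' in auto)
qed

text \<open>Differentiation under the integral sign. The first-order error is the primitive of the
  pointwise errors, and each of these is at most \<open>e / R\<close> times the increment because
  \<open>fs\<close> varies by less than that between \<open>s0\<close> and \<open>y\<close>,
  uniformly in the integration variable.\<close>

lemma prim_partial_s:
  assumes f: "jcont P f" "partials P f fs ft" and fs: "jcont P fs" and p: "p \<in> topspace P"
  shows "((\<lambda>s. prim (f p s) \<theta>) has_vector_derivative prim (fs p s0) \<theta>) (at s0)"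
  unfolding has_vector_derivative_def has_derivative_at_alt
proof (intro conjI allI impI)
  fix e :: real assume e: "e > 0"
  define R where "R = \<bar>\<theta>\<bar> + 1"
  have R: "R > 0" by (simp add: R_def)
  obtain U d where U: "openin P U" "p \<in> U" "d > 0"
    "\<And>q s \<theta>. q \<in> U \<Longrightarrow> dist s s0 < d \<Longrightarrow> \<bar>\<theta>\<bar> \<le> R \<Longrightarrow> dist (fs q s \<theta>) (fs p s0 \<theta>) < e / R"
    using jcont_uniform[OF fs p, of "e / R" s0 R] e R by auto
  note cf = jcont_slice[OF f(1) p] and cs = jcont_slice[OF fs p]
  show "\<exists>d>0. \<forall>y. norm (y - s0) < d \<longrightarrow>
      norm (prim (f p y) \<theta> - prim (f p s0) \<theta> - (y - s0) *\<^sub>R prim (fs p s0) \<theta>) \<le> e * norm (y - s0)"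
  proof (intro exI[of _ d] conjI allI impI)
    fix y assume y: "norm (y - s0) < d"
    let ?g = "\<lambda>x. f p y x - f p s0 x - (y - s0) *\<^sub>R fs p s0 x"
    have eq: "prim ?g \<theta> = prim (f p y) \<theta> - prim (f p s0) \<theta> - (y - s0) *\<^sub>R prim (fs p s0) \<theta>"
      by (subst prim_diff prim_scaleR; (intro continuous_intros cf cs)?)+ simp
    have "norm (prim ?g \<theta>) \<le> (e / R * norm (y - s0)) * R"
    proof (rule prim_bound)
      show "continuous_on UNIV ?g" by (intro continuous_intros cf cs)
      fix x assume x: "\<bar>x\<bar> \<le> R"
      have "norm (f p y x - f p s0 x - (y - s0) *\<^sub>R fs p s0 x) \<le> norm (y - s0) * (e / R)"
      proof (rule vector_differentiable_bound_linearization[of "ball s0 d" "\<lambda>s. f p s x" "\<lambda>s. fs p s x" s0 y s0])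
        show "((\<lambda>s. f p s x) has_vector_derivative fs p s x) (at s within ball s0 d)" for s
          using partials_D1[OF f(2) p] by (rule has_vector_derivative_at_within)
        show "closed_segment s0 y \<subseteq> ball s0 d"
          using y U(3) by (intro closed_segment_subset) (auto simp: dist_norm norm_minus_commute)
        show "norm (fs p s x - fs p s0 x) \<le> e / R" if "s \<in> ball s0 d" for s
          using U(4)[of p s x] U(2) x that by (simp add: dist_norm norm_minus_commute abs_minus_commute)
      qed (use U in auto)
      then show "norm (?g x) \<le> e / R * norm (y - s0)" by (simp add: mult.commute)
    qed (simp add: R_def)
    then show "norm (prim (f p y) \<theta> - prim (f p s0) \<theta> - (y - s0) *\<^sub>R prim (fs p s0) \<theta>) \<le> e * norm (y - s0)"
      unfolding eq using R by simp
  qed (fact U(3))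
qed (rule bounded_linear_scaleR_left)

lemma Cn_prim: "Cn P n f \<Longrightarrow> Cn P n (\<lambda>p s \<theta>. prim (f p s) \<theta>)"
proof (induction n arbitrary: f)
  case 0
  then show ?case by (simp add: jcont_prim)
next
  case (Suc n)
  from Suc.prems obtain fs ft where f: "jcont P f" "partials P f fs ft" "Cn P n fs" "Cn P n ft" "Cn P n f"
    by (elim Cn_SucE)
  have "partials P (\<lambda>p s \<theta>. prim (f p s) \<theta>) (\<lambda>p s \<theta>. prim (fs p s) \<theta>) f"
    by (rule partials_I[OF prim_partial_s[OF f(1,2) Cn_jcont[OF f(3)]]
        prim_has_vector_derivative[OF jcont_slice[OF f(1)]]])
  with jcont_prim[OF f(1)] show ?case by (rule Cn_SucI) (intro Suc.IH f)+
qed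

section \<open>Inverse functions depending on parameters\<close>

lemma jcont_inverse_fun:
  assumes f: "jcont P f" and mono: "\<And>p s. p \<in> topspace P \<Longrightarrow> strict_mono (f p s)"
    and inv: "\<And>p s y. p \<in> topspace P \<Longrightarrow> f p s (g p s y) = y"
  shows "jcont P g"
  unfolding jcont_iff
proof (intro ballI allI impI)
  fix p0 s0 y0 and e :: real
  assume p0: "p0 \<in> topspace P" and e: "e > 0"
  define x where "x = g p0 s0 y0"
  have a: "f p0 s0 (x - e) < y0" "y0 < f p0 s0 (x + e)"
    using strict_monoD[OF mono[OF p0], of "x - e" x s0] strict_monoD[OF mono[OF p0], of x "x + e" s0] e inv[OF p0, of s0 y0]
    by (auto simp: x_def)
  \<comment> \<open>Half of the smaller gap: one \<open>m\<close> pays for moving \<open>f\<close>,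
    the other for moving \<open>y\<close>. The strict inequalities at \<open>x - e\<close> and
    \<open>x + e\<close> survive, and monotonicity traps \<open>g p s y\<close> between these
    points.\<close>
  define m where "m = min (y0 - f p0 s0 (x - e)) (f p0 s0 (x + e) - y0) / 2"
  have m: "m > 0" using a by (simp add: m_def)
  obtain U d where U: "openin P U" "p0 \<in> U" "d > 0"
    "\<And>p s \<theta>. p \<in> U \<Longrightarrow> dist s s0 < d \<Longrightarrow> \<bar>\<theta>\<bar> \<le> \<bar>x\<bar> + e \<Longrightarrow> dist (f p s \<theta>) (f p0 s0 \<theta>) < m"
    using jcont_uniform[OF f p0 m, of s0 "\<bar>x\<bar> + e"] by auto
  show "\<exists>U d. openin P U \<and> p0 \<in> U \<and> d > 0 \<and>
     (\<forall>p\<in>U. \<forall>s y. dist s s0 < d \<longrightarrow> dist y y0 < d \<longrightarrow> dist (g p s y) (g p0 s0 y0) < e)"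
  proof (intro exI[of _ U] exI[of _ "min d m"] conjI ballI allI impI)
    fix p s y assume *: "p \<in> U" "dist s s0 < min d m" "dist y y0 < min d m"
    have p: "p \<in> topspace P" using U(1) *(1) openin_subset by blast
    have "dist (f p s (x - e)) (f p0 s0 (x - e)) < m" "dist (f p s (x + e)) (f p0 s0 (x + e)) < m"
      using * e by (auto intro!: U(4))
    then have "f p s (x - e) < y" "y < f p s (x + e)"
      using *(3) m by (auto simp: m_def dist_real_def abs_if min_def split: if_splits)
    then have "f p s (x - e) < f p s (g p s y)" "f p s (g p s y) < f p s (x + e)"
      using inv[OF p] by auto
    then have "x - e < g p s y" "g p s y < x + e"
      using strict_mono_less[OF mono[OF p]] by blast+
    then show "dist (g p s y) (g p0 s0 y0) < e" by (auto simp: dist_real_def x_def)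
  qed (use U m in auto)
qed

text \<open>Both partials of \<open>g\<close> are expressions in the partials of \<open>f\<close>
  evaluated at \<open>g\<close>, so \<open>g\<close> gains one order from each order it already has.
  The orders of \<open>f\<close> used grow along the induction, whence the hypothesis for all
  \<open>n\<close>.\<close>

lemma Cn_inverse_fun:
  assumes f: "\<And>n. Cn P n f" and pos: "\<And>p s \<theta>. p \<in> topspace P \<Longrightarrow> D (f p s) \<theta> > (0::real)"
    and mono: "\<And>p s. p \<in> topspace P \<Longrightarrow> strict_mono (f p s)"
    and inv: "\<And>p s y. p \<in> topspace P \<Longrightarrow> f p s (g p s y) = y"
  shows "Cn P n g"
proof (induction n)
  case 0
  show ?case using jcont_inverse_fun[OF Cn_jcont[OF f[of 0]] mono inv] by simp
next
  case (Suc n)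
  have jg: "jcont P g" by (rule jcont_inverse_fun[OF Cn_jcont[OF f[of 0]] mono inv])
  obtain fs ft where F: "jcont P f" "partials P f fs ft" "Cn P n fs" "Cn P n ft"
    using f[of "Suc n"] by (elim Cn_SucE)
  have ft: "ft p s \<theta> > 0" if "p \<in> topspace P" for p s \<theta>
    using pos[OF that, of s \<theta>] vector_derivative_at[OF partials_D2[OF F(2) that]] by (simp add: D_def)
  let ?w = "\<lambda>p s y. inverse (ft p s (g p s y))"
  have w: "Cn P n ?w"
    by (rule Cn_inverse[OF _ Cn_reparam[OF F(4) Suc.IH]]) (metis ft less_irrefl)
  have "(g p s has_vector_derivative ?w p s y) (at y)" if p: "p \<in> topspace P" for p s y
  proof -
    have "(g p s has_real_derivative ?w p s y) (at y)"
    proof (rule DERIV_inverse_function[where a = "y - 1" and b = "y + 1"])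
      show "(f p s has_real_derivative ft p s (g p s y)) (at (g p s y))"
        using partials_D2[OF F(2) p] by (simp add: has_real_derivative_iff_has_vector_derivative)
      show "isCont (g p s) y" using jcont_slice[OF jg p] by (simp add: continuous_on_eq_continuous_at)
    qed (use ft[OF p, of s "g p s y"] inv[OF p] in auto)
    then show ?thesis by (simp add: has_real_derivative_iff_has_vector_derivative)
  qed
  moreover have "((\<lambda>s. g p s y) has_vector_derivative - (fs p s (g p s y) * ?w p s y)) (at s)"
    if p: "p \<in> topspace P" for p s y
  proof -
    let ?x = "g p s y"
    \<comment> \<open>For the derivative in \<open>s\<close>, the inverse is taken in the plane: (s,
      theta) \<mapsto> (s, f p s theta) has an invertible triangular derivative, and its inverse
      \<open>?g\<close> is already known to be continuous.\<close>
    let ?f = "\<lambda>x. (fst x, f p (fst x) (snd x))" and ?g = "\<lambda>x. (fst x, g p (fst x) (snd x))"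
    have d2: "((\<lambda>z. (fst z, f p (fst z) (snd z))) has_derivative
        (\<lambda>t. (fst t, fst t * fs p s ?x + snd t * ft p s ?x))) (at (?g (s, y)))"
      using partials_has_derivative[OF F(2) Cn_jcont[OF F(4)] p, of s ?x]
      by (intro has_derivative_Pair) (auto intro: derivative_intros)
    have "(?g has_derivative (\<lambda>t. (fst t, (snd t - fst t * fs p s ?x) * inverse (ft p s ?x)))) (at (s, y))"
    proof (rule has_derivative_inverse_basic[where g = ?g and y = "(s, y)" and T = UNIV, OF d2])
      show "bounded_linear (\<lambda>t. (fst t, (snd t - fst t * fs p s ?x) * inverse (ft p s ?x)))"
        by (intro bounded_linear_Pair bounded_linear_fst bounded_linear_mult_left[THEN bounded_linear_compose]
          bounded_linear_sub bounded_linear_snd)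
      show "(\<lambda>t. (fst t, (snd t - fst t * fs p s ?x) * inverse (ft p s ?x))) \<circ>
          (\<lambda>t. (fst t, fst t * fs p s ?x + snd t * ft p s ?x)) = id"
        using ft[OF p, of s ?x] by (auto simp: o_def)
      have "isCont (\<lambda>x. g p (fst x) (snd x)) (s, y)"
        using jcont_slice2[OF jg p] by (simp add: continuous_on_eq_continuous_at)
      then show "continuous (at (s, y)) ?g" by (intro continuous_intros) auto
      show "?f (?g z) = z" for z using inv[OF p] by simp
    qed auto
    moreover have "((\<lambda>x. (x, y)) has_derivative (\<lambda>t. (t, 0))) (at s)"
      by (intro derivative_intros)
    ultimately have "(?g \<circ> (\<lambda>x. (x, y)) has_derivative
      (\<lambda>t. (fst t, (snd t - fst t * fs p s ?x) * inverse (ft p s ?x))) \<circ> (\<lambda>t. (t, 0))) (at s)"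
      by (intro diff_chain_at)
    from has_derivative_snd[OF this] show ?thesis
      unfolding has_vector_derivative_def by (simp add: o_def algebra_simps)
  qed
  ultimately have "partials P g (\<lambda>p s y. - (fs p s (g p s y) * ?w p s y)) ?w"
    by (intro partials_I)
  with jg show ?case
    by (rule Cn_SucI)
      (rule w Cn_linear[OF bounded_linear_minus[OF bounded_linear_ident]
        Cn_bilinear[OF bounded_bilinear_mult Cn_reparam[OF F(3) Suc.IH] w]])+
qed

section \<open>The calculus of smooth families\<close>

lemma smooth_fam_Cn: "smooth_fam P f \<Longrightarrow> Cn P n f"
  by (simp add: smooth_fam_def)

lemma smooth_fam_jcont: "smooth_fam P f \<Longrightarrow> jcont P f"
  using Cn_jcont smooth_fam_Cn by blast

lemma smooth_fam_const: "smooth_fam P (\<lambda>p s \<theta>. a)"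
  by (simp add: smooth_fam_def Cn_const)

lemma smooth_fam_theta: "smooth_fam P (\<lambda>p s \<theta>. \<theta>)"
  by (simp add: smooth_fam_def Cn_theta)

lemma smooth_fam_s: "smooth_fam P (\<lambda>p s \<theta>. s)"
  by (simp add: smooth_fam_def Cn_s)

lemma smooth_fam_param: "continuous_map P euclidean a \<Longrightarrow> smooth_fam P (\<lambda>p s \<theta>. a p)"
  by (simp add: smooth_fam_def Cn_param)

lemma smooth_fam_linear: "bounded_linear h \<Longrightarrow> smooth_fam P f \<Longrightarrow> smooth_fam P (\<lambda>p s \<theta>. h (f p s \<theta>))"
  by (simp add: smooth_fam_def Cn_linear)

lemma smooth_fam_bilinear:
  "bounded_bilinear h \<Longrightarrow> smooth_fam P f \<Longrightarrow> smooth_fam P g \<Longrightarrow> smooth_fam P (\<lambda>p s \<theta>. h (f p s \<theta>) (g p s \<theta>))"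
  by (simp add: smooth_fam_def Cn_bilinear)

lemmas smooth_fam_scaleR = smooth_fam_bilinear[OF bounded_bilinear_scaleR]
lemmas smooth_fam_mult = smooth_fam_bilinear[OF bounded_bilinear_mult]
lemmas smooth_fam_Im = smooth_fam_linear[OF bounded_linear_Im]
lemmas smooth_fam_of_real = smooth_fam_linear[OF bounded_linear_of_real]

lemma smooth_fam_add: "smooth_fam P f \<Longrightarrow> smooth_fam P g \<Longrightarrow> smooth_fam P (\<lambda>p s \<theta>. f p s \<theta> + g p s \<theta>)"
  by (simp add: smooth_fam_def Cn_add)

lemma smooth_fam_diff: "smooth_fam P f \<Longrightarrow> smooth_fam P g \<Longrightarrow> smooth_fam P (\<lambda>p s \<theta>. f p s \<theta> - g p s \<theta>)"
  using smooth_fam_add[OF _ smooth_fam_linear[OF bounded_linear_minus[OF bounded_linear_ident]], of P f g] by simp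

lemma smooth_fam_exp:
  fixes f :: "'p \<Rightarrow> real \<Rightarrow> real \<Rightarrow> complex"
  shows "smooth_fam P f \<Longrightarrow> smooth_fam P (\<lambda>p s \<theta>. exp (f p s \<theta>))"
  by (simp add: smooth_fam_def Cn_exp)

lemma smooth_fam_divide:
  fixes f g :: "'p \<Rightarrow> real \<Rightarrow> real \<Rightarrow> 'a::real_normed_field"
  assumes "smooth_fam P f" "smooth_fam P g" "\<And>p s \<theta>. p \<in> topspace P \<Longrightarrow> g p s \<theta> \<noteq> 0"
  shows "smooth_fam P (\<lambda>p s \<theta>. f p s \<theta> / g p s \<theta>)"
  using assms by (simp add: divide_inverse smooth_fam_def Cn_inverse Cn_bilinear[OF bounded_bilinear_mult])

lemma smooth_fam_norm:
  fixes f :: "'p \<Rightarrow> real \<Rightarrow> real \<Rightarrow> 'a::real_inner"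
  assumes "smooth_fam P f" "\<And>p s \<theta>. p \<in> topspace P \<Longrightarrow> f p s \<theta> \<noteq> 0"
  shows "smooth_fam P (\<lambda>p s \<theta>. norm (f p s \<theta>))"
  using assms by (simp add: smooth_fam_def Cn_norm)

lemma smooth_fam_prim: "smooth_fam P f \<Longrightarrow> smooth_fam P (\<lambda>p s \<theta>. prim (f p s) \<theta>)"
  by (simp add: smooth_fam_def Cn_prim)

lemma smooth_fam_reparam:
  "smooth_fam P f \<Longrightarrow> smooth_fam P b \<Longrightarrow> smooth_fam P (\<lambda>p s \<theta>. f p s (b p s \<theta>))"
  by (simp add: smooth_fam_def Cn_reparam)

lemma smooth_fam_eval: "smooth_fam P f \<Longrightarrow> smooth_fam P (\<lambda>p s \<theta>. f p s a)"
  by (rule smooth_fam_reparam[OF _ smooth_fam_const])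

lemma smooth_fam_inverse_fun:
  assumes "smooth_fam P f" "\<And>p s \<theta>. p \<in> topspace P \<Longrightarrow> D (f p s) \<theta> > (0::real)"
    "\<And>p s. p \<in> topspace P \<Longrightarrow> strict_mono (f p s)"
    "\<And>p s y. p \<in> topspace P \<Longrightarrow> f p s (g p s y) = y"
  shows "smooth_fam P g"
  using Cn_inverse_fun[of P f g] assms unfolding smooth_fam_def by blast

lemma D_eqI: "(\<And>\<theta>. (f has_vector_derivative f' \<theta>) (at \<theta>)) \<Longrightarrow> D f = f'"
  by (auto simp: D_def fun_eq_iff vector_derivative_at)

lemma
  assumes "smooth_fam P f" and p: "p \<in> topspace P"
  shows smooth_fam_has_D: "(f p s has_vector_derivative D (f p s) \<theta>) (at \<theta>)"
    and smooth_fam_differentiable_s: "(\<lambda>x. f p x \<theta>) differentiable (at s)"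
proof -
  obtain fs ft where F: "partials P f fs ft"
    using smooth_fam_Cn[OF assms(1), of "Suc 0"] by (elim Cn_SucE)
  show "(f p s has_vector_derivative D (f p s) \<theta>) (at \<theta>)"
    using partials_D2[OF F p] D_eqI[of "f p s" "ft p s"] by simp
  show "(\<lambda>x. f p x \<theta>) differentiable (at s)"
    using partials_D1[OF F p] by (auto simp: has_vector_derivative_def differentiable_def)
qed

text \<open>The witnesses in \<open>Cn\<close> are the true derivatives only over
  \<open>topspace P\<close>, so they are exchanged for \<open>vector_derivative\<close> through
  \<open>Cn_cong\<close>.\<close>

lemma smooth_fam_vector_derivatives:
  assumes "smooth_fam P f"
  shows "smooth_fam P (\<lambda>p s \<theta>. vector_derivative (\<lambda>x. f p x \<theta>) (at s))"
    and "smooth_fam P (\<lambda>p s \<theta>. vector_derivative (f p s) (at \<theta>))"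
proof -
  have "Cn P n (\<lambda>p s \<theta>. vector_derivative (\<lambda>x. f p x \<theta>) (at s)) \<and>
      Cn P n (\<lambda>p s \<theta>. vector_derivative (f p s) (at \<theta>))" for n
  proof -
    obtain fs ft where F: "partials P f fs ft" "Cn P n fs" "Cn P n ft"
      using smooth_fam_Cn[OF assms, of "Suc n"] by (elim Cn_SucE)
    have "fs p = (\<lambda>s \<theta>. vector_derivative (\<lambda>x. f p x \<theta>) (at s))"
      and "ft p = (\<lambda>s \<theta>. vector_derivative (f p s) (at \<theta>))" if "p \<in> topspace P" for p
      using vector_derivative_at[OF partials_D1[OF F(1) that]] vector_derivative_at[OF partials_D2[OF F(1) that]]
      by (simp_all add: fun_eq_iff)
    with F(2,3) show ?thesis by (auto intro: Cn_cong)
  qed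
  then show "smooth_fam P (\<lambda>p s \<theta>. vector_derivative (\<lambda>x. f p x \<theta>) (at s))"
    "smooth_fam P (\<lambda>p s \<theta>. vector_derivative (f p s) (at \<theta>))" by (auto simp: smooth_fam_def)
qed

lemma smooth_fam_D: "smooth_fam P f \<Longrightarrow> smooth_fam P (\<lambda>p s \<theta>. D (f p s) \<theta>)"
  unfolding D_def by (rule smooth_fam_vector_derivatives)

lemma smooth_fam_D_funpow: "smooth_fam P f \<Longrightarrow> smooth_fam P (\<lambda>p s. (D ^^ j) (f p s))"
  by (induction j) (use smooth_fam_D in auto)

section \<open>Comparison with \<open>smooth_fun\<close> and \<open>smooth2\<close>\<close>

lemma smooth_fam_imp_smooth_fun:
  assumes "smooth_fam P f" "p \<in> topspace P"
  shows "smooth_fun (f p s)"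
  unfolding smooth_fun_def
proof (intro allI)
  fix j \<theta>
  from smooth_fam_has_D[OF smooth_fam_D_funpow[OF assms(1), of j] assms(2)]
  show "(D ^^ j) (f p s) differentiable (at \<theta>)"
    by (auto simp: has_vector_derivative_def differentiable_def)
qed

lemma smooth_fun_has_D:
  assumes "smooth_fun f"
  shows "((D ^^ j) f has_vector_derivative (D ^^ Suc j) f \<theta>) (at \<theta>)"
  using assms vector_derivative_works unfolding smooth_fun_def by (auto simp: D_def)

lemma smooth_fun_imp_smooth_fam:
  assumes "smooth_fun h"
  shows "smooth_fam P (\<lambda>p s \<theta>. h \<theta>)"
proof -
  have "Cn P n (\<lambda>p s. (D ^^ j) h)" for n j
  proof (induction n arbitrary: j)
    have jc: "jcont P (\<lambda>p s. (D ^^ j) h)" for j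
    proof (rule jcont_real2)
      have "continuous_on UNIV ((D ^^ j) h)"
        using smooth_fun_has_D[OF assms] by (meson continuous_at_imp_continuous_on has_vector_derivative_continuous)
      then show "continuous_on UNIV (\<lambda>x. (D ^^ j) h (snd x))"
        by (rule continuous_on_compose2) (auto intro: continuous_intros)
    qed
    case 0
    show ?case using jc by simp
    case (Suc n)
    have "partials P (\<lambda>p s. (D ^^ j) h) (\<lambda>p s \<theta>. 0) (\<lambda>p s. (D ^^ Suc j) h)"
      by (rule partials_I) (simp, rule smooth_fun_has_D[OF assms])
    with jc show ?case by (rule Cn_SucI) (rule Cn_const Suc.IH)+
  qed
  from this[of _ 0] show ?thesis by (simp add: smooth_fam_def)
qed

abbreviation pt :: "unit topology" where
  "pt \<equiv> discrete_topology UNIV"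

lemma smooth_fun_iff_smooth_fam: "smooth_fun h \<longleftrightarrow> smooth_fam pt (\<lambda>_ _. h)"
  using smooth_fun_imp_smooth_fam[of h pt] smooth_fam_imp_smooth_fun[of pt "\<lambda>_ _. h" "()"] by auto

text \<open>Proving the claim for all words \<open>bs\<close> of derivatives at once makes the
  induction close: the partials of \<open>pds bs F\<close> are again of this form.\<close>

lemma smooth2_iff_smooth_fam: "smooth2 F \<longleftrightarrow> smooth_fam pt (\<lambda>_. F)"
proof
  assume F: "smooth2 F"
  have "Cn pt n (\<lambda>_. pds bs F)" for n bs
  proof (induction n arbitrary: bs)
    have jc: "jcont pt (\<lambda>_. pds bs F)" for bs
      by (rule jcont_real2) (use F in \<open>auto simp: smooth2_def case_prod_unfold\<close>)
    case 0
    show ?case using jc by simp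
    case (Suc n)
    have "partials pt (\<lambda>_. pds bs F) (\<lambda>_. pds (True # bs) F) (\<lambda>_. pds (False # bs) F)"
      using F unfolding partials_def smooth2_def
      by (simp add: pd_s_def pd_t_def vector_derivative_works[symmetric])
    with jc show ?case by (rule Cn_SucI) (rule Suc.IH)+
  qed
  from this[of _ "[]"] show "smooth_fam pt (\<lambda>_. F)" by (simp add: smooth_fam_def)
next
  assume F: "smooth_fam pt (\<lambda>_. F)"
  have bs: "smooth_fam pt (\<lambda>_. pds bs F)" for bs
    by (induction bs) (use F smooth_fam_vector_derivatives in \<open>auto simp: pd_s_def pd_t_def\<close>)
  show "smooth2 F"
    unfolding smooth2_def
  proof (intro allI conjI)
    fix bs s \<theta>
    have "continuous_map euclidean (prod_topology pt euclidean) (\<lambda>x :: real \<times> real. ((), x))"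
      by (intro continuous_map_pairedI) auto
    from continuous_map_compose[OF this smooth_fam_jcont[OF bs, of bs, unfolded jcont_def]]
    show "continuous_on UNIV (\<lambda>(s, \<theta>). pds bs F s \<theta>)" by (simp add: o_def case_prod_unfold)
    show "(\<lambda>s'. pds bs F s' \<theta>) differentiable (at s)"
      using smooth_fam_differentiable_s[OF bs] by simp
    show "pds bs F s differentiable (at \<theta>)"
      using smooth_fam_has_D[OF bs] by (auto simp: has_vector_derivative_def differentiable_def)
  qed
qed

lemma smooth_fam_pullback:
  fixes f :: "'p \<Rightarrow> real \<Rightarrow> real \<Rightarrow> 'a::real_normed_vector" and h :: "'q \<Rightarrow> 'p"
  assumes h: "continuous_map Q P h" and f: "smooth_fam P f"
  shows "smooth_fam Q (\<lambda>q. f (h q))"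
proof -
  have jc: "jcont Q (\<lambda>q. f (h q))" if "jcont P f" for f :: "'p \<Rightarrow> real \<Rightarrow> real \<Rightarrow> 'a"
  proof -
    have "continuous_map (prod_topology Q euclidean) (prod_topology P euclidean)
       (\<lambda>x :: 'q \<times> real \<times> real. (h (fst x), snd x))"
      by (intro continuous_map_pairedI continuous_map_compose[OF continuous_map_fst h, unfolded o_def]
        continuous_map_snd)
    from continuous_map_compose[OF this that[unfolded jcont_def]] show ?thesis
      by (simp add: jcont_def o_def case_prod_unfold)
  qed
  have "Cn P n f \<Longrightarrow> Cn Q n (\<lambda>q. f (h q))" for n
  proof (induction n arbitrary: f)
    case 0
    then show ?case using jc by simp
  next
    case (Suc n)
    from Suc.prems obtain fs ft where f: "jcont P f" "partials P f fs ft" "Cn P n fs" "Cn P n ft"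
      by (elim Cn_SucE)
    have "partials Q (\<lambda>q. f (h q)) (\<lambda>q. fs (h q)) (\<lambda>q. ft (h q))"
      using f(2) continuous_map_funspace[OF h] unfolding partials_def by auto
    with jc[OF f(1)] show ?case by (rule Cn_SucI) (intro Suc.IH f)+
  qed
  with f show ?thesis by (simp add: smooth_fam_def)
qed

section \<open>The topology on immersions\<close>

lemma periodic2pi_int: "periodic2pi f \<Longrightarrow> f (\<theta> + 2 * pi * of_int n) = f \<theta>"
proof -
  assume f: "periodic2pi f"
  have nat: "f (x + 2 * pi * of_nat m) = f x" for x m
  proof (induction m)
    case (Suc m)
    have "f (x + 2 * pi * of_nat (Suc m)) = f ((x + 2 * pi * of_nat m) + 2 * pi)" by (simp add: algebra_simps)
    then show ?case using f Suc by (simp add: periodic2pi_def)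
  qed simp
  show ?thesis
  proof (cases n rule: int_cases2)
    case (nonpos m)
    then show ?thesis using nat[of "\<theta> + 2 * pi * of_int n" m] by simp
  qed (simp add: nat)
qed

lemma reduce_mod_2pi:
  obtains n :: int and \<theta>' where "\<theta> = \<theta>' + 2 * pi * of_int n" "0 \<le> \<theta>'" "\<theta>' \<le> 2 * pi"
proof
  let ?n = "\<lfloor>\<theta> / (2 * pi)\<rfloor>"
  show "\<theta> = (\<theta> - 2 * pi * of_int ?n) + 2 * pi * of_int ?n" by simp
  have "of_int ?n \<le> \<theta> / (2 * pi)" "\<theta> / (2 * pi) \<le> of_int ?n + 1" by linarith+
  then show "0 \<le> \<theta> - 2 * pi * of_int ?n" "\<theta> - 2 * pi * of_int ?n \<le> 2 * pi"
    using pos_le_divide_eq[of "2 * pi" "of_int ?n" \<theta>] pos_divide_le_eq[of "2 * pi" \<theta> "of_int ?n + 1"]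
    by (simp_all add: algebra_simps)
qed

text \<open>Translation shows that the same vectors \<open>v\<close> are derivatives at both points,
  so the choice made by \<open>vector_derivative\<close> agrees, also where \<open>c\<close> has no
  derivative.\<close>

lemma periodic2pi_D:
  assumes "periodic2pi c"
  shows "periodic2pi (D c)"
proof -
  have eq: "c = c \<circ> (\<lambda>x. x + 2 * pi)"
    using assms by (auto simp: periodic2pi_def)
  have "(c has_vector_derivative v) (at (\<theta> + 2 * pi)) \<longleftrightarrow> (c has_vector_derivative v) (at \<theta>)" for v \<theta>
  proof
    assume "(c has_vector_derivative v) (at (\<theta> + 2 * pi))"
    then have "(c \<circ> (\<lambda>x. x + 2 * pi) has_vector_derivative (1 *\<^sub>R v)) (at \<theta>)"
      by (intro vector_diff_chain_at) (auto intro!: derivative_eq_intros)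
    then show "(c has_vector_derivative v) (at \<theta>)" by (simp flip: eq)
  next
    assume "(c has_vector_derivative v) (at \<theta>)"
    then have "(c \<circ> (\<lambda>x. x - 2 * pi) has_vector_derivative (1 *\<^sub>R v)) (at (\<theta> + 2 * pi))"
      by (intro vector_diff_chain_at) (auto intro!: derivative_eq_intros)
    moreover have "c \<circ> (\<lambda>x. x - 2 * pi) = c"
      using assms unfolding periodic2pi_def by (auto simp: fun_eq_iff) (metis diff_add_cancel)
    ultimately show "(c has_vector_derivative v) (at (\<theta> + 2 * pi))" by simp
  qed
  then show ?thesis by (simp add: periodic2pi_def D_def vector_derivative_def)
qed

lemma periodic2pi_D_funpow: "periodic2pi c \<Longrightarrow> periodic2pi ((D ^^ j) c)"
  by (induction j) (auto intro: periodic2pi_D)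

lemma topspace_imm_top [simp]: "topspace (imm_top k) = Imm_k k"
proof (rule antisym)
  have "Cinf_open k (topspace (imm_top k))" by (metis openin_imm_top openin_topspace)
  then show "topspace (imm_top k) \<subseteq> Imm_k k" by (simp add: Cinf_open_def)
  have "openin (imm_top k) (Imm_k k)" unfolding openin_imm_top Cinf_open_def by (auto intro!: exI[of _ 1])
  then show "Imm_k k \<subseteq> topspace (imm_top k)" by (rule openin_subset)
qed

lemma Imm_k_D:
  assumes "c \<in> Imm_k k"
  shows "periodic2pi c" "smooth_fun c" "D c \<theta> \<noteq> 0" "imm_degree c = of_int k"
  using assms by (auto simp: Imm_k_def Imm_def)

text \<open>A basic neighbourhood bounds finitely many derivatives on the whole line. Periodicity
  reduces each bound to [0, 2 pi], where \<open>jcont_uniform\<close> applies, and finitely many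
  open sets are intersected.\<close>

lemma continuous_map_into_imm_top:
  assumes T: "smooth_fam P (\<lambda>p s. T p)" and im: "\<And>p. p \<in> topspace P \<Longrightarrow> T p \<in> Imm_k k"
  shows "continuous_map P (imm_top k) T"
  unfolding continuous_map_def
proof (intro conjI allI impI)
  show "T \<in> topspace P \<rightarrow> topspace (imm_top k)" using im by simp
  fix U assume U: "openin (imm_top k) U"
  show "openin P {p \<in> topspace P. T p \<in> U}"
  proof (subst openin_subopen, clarify)
    fix p0 assume p0: "p0 \<in> topspace P" "T p0 \<in> U"
    then obtain n e where e: "e > 0" "{d \<in> Imm_k k. \<forall>j\<le>n. \<forall>\<theta>. norm ((D ^^ j) d \<theta> - (D ^^ j) (T p0) \<theta>) < e} \<subseteq> U"
      using U unfolding openin_imm_top Cinf_open_def by blast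
    have "\<exists>W. openin P W \<and> p0 \<in> W \<and> (\<forall>p\<in>W. \<forall>\<theta>. norm ((D ^^ j) (T p) \<theta> - (D ^^ j) (T p0) \<theta>) < e)" for j
    proof -
      obtain W d where W: "openin P W" "p0 \<in> W" "d > 0"
        "\<And>p s \<theta>. p \<in> W \<Longrightarrow> dist s (0::real) < d \<Longrightarrow> \<bar>\<theta>\<bar> \<le> 2 * pi \<Longrightarrow>
           dist ((D ^^ j) (T p) \<theta>) ((D ^^ j) (T p0) \<theta>) < e"
        using jcont_uniform[OF smooth_fam_jcont[OF smooth_fam_D_funpow[OF T, of j]] p0(1) e(1), of 0 "2 * pi"]
        by metis
      show ?thesis
      proof (intro exI[of _ W] conjI ballI allI W)
        fix p \<theta> assume p: "p \<in> W"
        then have "T p \<in> Imm_k k" using im W(1) openin_subset by blast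
        then have per: "periodic2pi ((D ^^ j) (T p))" "periodic2pi ((D ^^ j) (T p0))"
          using im[OF p0(1)] by (auto intro: periodic2pi_D_funpow dest: Imm_k_D)
        obtain m :: int and \<theta>' where m: "\<theta> = \<theta>' + 2 * pi * of_int m" "0 \<le> \<theta>'" "\<theta>' \<le> 2 * pi"
          by (rule reduce_mod_2pi)
        show "norm ((D ^^ j) (T p) \<theta> - (D ^^ j) (T p0) \<theta>) < e"
          using W(4)[OF p, of 0 \<theta>'] W(3) m per by (simp add: periodic2pi_int dist_norm)
      qed
    qed
    then obtain W where W: "\<And>j. openin P (W j)" "\<And>j. p0 \<in> W j"
      "\<And>j p \<theta>. p \<in> W j \<Longrightarrow> norm ((D ^^ j) (T p) \<theta> - (D ^^ j) (T p0) \<theta>) < e"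
      by metis
    show "\<exists>V. openin P V \<and> p0 \<in> V \<and> V \<subseteq> {p \<in> topspace P. T p \<in> U}"
    proof (intro exI[of _ "\<Inter>j\<in>{..n}. W j"] conjI)
      show op: "openin P (\<Inter>j\<in>{..n}. W j)" using W by (intro openin_INT2) auto
      show "p0 \<in> (\<Inter>j\<in>{..n}. W j)" using W by auto
      show "(\<Inter>j\<in>{..n}. W j) \<subseteq> {p \<in> topspace P. T p \<in> U}"
      proof
        fix p assume p: "p \<in> (\<Inter>j\<in>{..n}. W j)"
        then have "p \<in> topspace P" using openin_subset[OF op] by blast
        moreover have "T p \<in> U"
          by (rule subsetD[OF e(2)]) (use p W(3) im calculation in auto)
        ultimately show "p \<in> {p \<in> topspace P. T p \<in> U}" by simp
      qed
    qed
  qed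
qed

text \<open>The tautological family, from which every formula in a varying immersion inherits
  continuity. Evaluation of each derivative is jointly continuous since the topology controls that
  derivative uniformly in \<open>\<theta>\<close>.\<close>

lemma smooth_fam_imm_top: "smooth_fam (imm_top k) (\<lambda>c s. c)"
proof -
  have "Cn (imm_top k) n (\<lambda>c s. (D ^^ j) c)" for n j
  proof (induction n arbitrary: j)
    have jc: "jcont (imm_top k) (\<lambda>c s. (D ^^ j) c)" for j
      unfolding jcont_iff
    proof (intro ballI allI impI)
      fix c0 and s0 \<theta>0 e :: real
      assume c0: "c0 \<in> topspace (imm_top k)" and e: "e > 0"
      have "isCont ((D ^^ j) c0) \<theta>0"
        using smooth_fun_has_D[of c0] c0 by (auto dest!: Imm_k_D(2) intro: has_vector_derivative_continuous)
      then obtain d where d: "d > 0" "\<And>\<theta>. dist \<theta> \<theta>0 < d \<Longrightarrow> dist ((D ^^ j) c0 \<theta>) ((D ^^ j) c0 \<theta>0) < e / 2"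
        unfolding continuous_at_eps_delta using e by (meson half_gt_zero)
      \<comment> \<open>The uniform margin between \<open>r\<close> and \<open>e / 2\<close> leaves
        room for a ball of radius \<open>(e / 2 - r) / 2\<close> about each member; a strict bound
        at every single point would not display such a margin.\<close>
      define U where "U = {c \<in> Imm_k k. \<exists>r<e/2. \<forall>\<theta>. norm ((D ^^ j) c \<theta> - (D ^^ j) c0 \<theta>) \<le> r}"
      have "openin (imm_top k) U"
        unfolding openin_imm_top Cinf_open_def
      proof (intro conjI ballI)
        fix c assume "c \<in> U"
        then obtain r where r: "r < e / 2" "\<And>\<theta>. norm ((D ^^ j) c \<theta> - (D ^^ j) c0 \<theta>) \<le> r" by (auto simp: U_def)
        let ?r = "(e / 2 - r) / 2"
        show "\<exists>n. \<exists>\<epsilon>>0. {d \<in> Imm_k k. \<forall>j\<le>n. \<forall>\<theta>. norm ((D ^^ j) d \<theta> - (D ^^ j) c \<theta>) < \<epsilon>} \<subseteq> U"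
        proof (intro exI[of _ j] exI[of _ ?r] conjI subsetI)
          fix b assume b: "b \<in> {d \<in> Imm_k k. \<forall>j'\<le>j. \<forall>\<theta>. norm ((D ^^ j') d \<theta> - (D ^^ j') c \<theta>) < ?r}"
          have "norm ((D ^^ j) b \<theta> - (D ^^ j) c0 \<theta>) \<le> r + ?r" for \<theta>
          proof -
            have "norm ((D ^^ j) b \<theta> - (D ^^ j) c \<theta>) < ?r" using b by blast
            moreover have "norm ((D ^^ j) b \<theta> - (D ^^ j) c0 \<theta>)
                \<le> norm ((D ^^ j) b \<theta> - (D ^^ j) c \<theta>) + norm ((D ^^ j) c \<theta> - (D ^^ j) c0 \<theta>)"
              by norm
            ultimately show ?thesis using r(2)[of \<theta>] by linarith
          qed
          moreover have "r + ?r < e / 2" using r(1) by (simp add: field_simps)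
          ultimately show "b \<in> U" using b unfolding U_def by blast
        qed (use r in simp)
      qed (auto simp: U_def)
      moreover have "c0 \<in> U" using c0 e by (auto simp: U_def intro: exI[of _ 0])
      ultimately show "\<exists>U d. openin (imm_top k) U \<and> c0 \<in> U \<and> d > 0 \<and> (\<forall>p\<in>U. \<forall>s \<theta>. dist s s0 < d \<longrightarrow>
          dist \<theta> \<theta>0 < d \<longrightarrow> dist ((D ^^ j) p \<theta>) ((D ^^ j) c0 \<theta>0) < e)"
      proof (intro exI[of _ U] exI[of _ d] conjI ballI allI impI)
        fix c s \<theta> assume "c \<in> U" "dist \<theta> \<theta>0 < d"
        then obtain r where "r < e / 2" "norm ((D ^^ j) c \<theta> - (D ^^ j) c0 \<theta>) \<le> r"
          by (auto simp: U_def)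
        then have "dist ((D ^^ j) c \<theta>) ((D ^^ j) c0 \<theta>) < e / 2" by (simp add: dist_norm)
        moreover have "dist ((D ^^ j) c0 \<theta>) ((D ^^ j) c0 \<theta>0) < e / 2" using d \<open>dist \<theta> \<theta>0 < d\<close> by blast
        ultimately show "dist ((D ^^ j) c \<theta>) ((D ^^ j) c0 \<theta>0) < e"
          by (metis dist_commute dist_triangle_half_l)
      qed (use d in auto)
    qed
    case 0
    show ?case using jc by simp
    case (Suc n)
    have "partials (imm_top k) (\<lambda>c s. (D ^^ j) c) (\<lambda>c s \<theta>. 0) (\<lambda>c s. (D ^^ Suc j) c)"
      by (rule partials_I) (simp, metis smooth_fun_has_D Imm_k_D(2) topspace_imm_top)
    with jc show ?case by (rule Cn_SucI) (rule Cn_const Suc.IH)+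
  qed
  from this[of _ 0] show ?thesis by (simp add: smooth_fam_def)
qed

section \<open>Primitives and derivatives of single functions\<close>

lemma continuous_on_of_vector_derivative:
  "(\<And>x. (f has_vector_derivative f' x) (at x)) \<Longrightarrow> continuous_on UNIV f"
  by (meson continuous_at_imp_continuous_on has_vector_derivative_continuous)

lemma continuous_on_prim: "continuous_on UNIV f \<Longrightarrow> continuous_on UNIV (prim f)"
  by (rule continuous_on_of_vector_derivative[OF prim_has_vector_derivative])

lemma prim_linear:
  assumes "bounded_linear h" "continuous_on UNIV f"
  shows "prim (\<lambda>x. h (f x)) \<theta> = h (prim f \<theta>)"
proof -
  have "prim (\<lambda>x. h (f x)) \<theta> = h (prim f \<theta>) - h (prim f 0)"
    by (intro prim_unique bounded_linear.has_vector_derivative[OF assms(1)] prim_has_vector_derivative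
      assms bounded_linear.continuous_on[OF assms(1)])
  then show ?thesis using bounded_linear.linear[OF assms(1)] by (simp add: linear_0)
qed

lemma prim_const: "prim (\<lambda>x. a) \<theta> = \<theta> *\<^sub>R a"
  by (subst prim_unique[of "\<lambda>x. x *\<^sub>R a"]) (auto intro!: derivative_eq_intros simp: has_vector_derivative_def)

lemma prim_periodic:
  assumes f: "continuous_on UNIV f" "periodic2pi f"
  shows "prim f (\<theta> + 2 * pi) = prim f \<theta> + prim f (2 * pi)"
proof (rule eq_of_vector_derivative[where a = 0 and F = "\<lambda>\<theta>. prim f (\<theta> + 2 * pi)"])
  show "((\<lambda>\<theta>. prim f (\<theta> + 2 * pi)) has_vector_derivative f x) (at x)" for x
  proof -
    have "((\<lambda>x. x + 2 * pi) has_vector_derivative 1) (at x)" by (auto intro!: derivative_eq_intros)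
    from vector_diff_chain_at[OF this prim_has_vector_derivative[OF f(1)]]
    show ?thesis using f(2) by (simp add: o_def periodic2pi_def)
  qed
  show "((\<lambda>\<theta>. prim f \<theta> + prim f (2 * pi)) has_vector_derivative f x) (at x)" for x
    using has_vector_derivative_add[OF prim_has_vector_derivative[OF f(1)] has_vector_derivative_const] by simp
qed simp

lemma strict_mono_of_pos_derivative:
  fixes f :: "real \<Rightarrow> real"
  assumes "\<And>x. (f has_vector_derivative f' x) (at x)" "\<And>x. f' x > 0"
  shows "strict_mono f"
proof (rule strict_monoI)
  fix x y :: real assume "x < y"
  then show "f x < f y"
    by (rule DERIV_pos_imp_increasing)
      (use assms in \<open>unfold has_real_derivative_iff_has_vector_derivative, blast\<close>)
qed

lemma smooth_fun_D: "smooth_fun f \<Longrightarrow> (f has_vector_derivative D f x) (at x)"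
  and smooth_fun_DD: "smooth_fun f \<Longrightarrow> (D f has_vector_derivative D (D f) x) (at x)"
  and smooth_fun_DDD: "smooth_fun f \<Longrightarrow> (D (D f) has_vector_derivative D (D (D f)) x) (at x)"
  using smooth_fun_has_D[of f 0 x] smooth_fun_has_D[of f 1 x] smooth_fun_has_D[of f 2 x]
  by (auto simp: numeral_2_eq_2)

lemma smooth_fun_continuous: "smooth_fun f \<Longrightarrow> continuous_on UNIV f"
  and smooth_fun_continuous_D: "smooth_fun f \<Longrightarrow> continuous_on UNIV (D f)"
  and smooth_fun_continuous_DD: "smooth_fun f \<Longrightarrow> continuous_on UNIV (D (D f))"
  using continuous_on_of_vector_derivative smooth_fun_D smooth_fun_DD smooth_fun_DDD by metis+

lemma D_compose:
  assumes "smooth_fun c" "smooth_fun \<phi>"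
  shows "D (c \<circ> \<phi>) \<theta> = D \<phi> \<theta> *\<^sub>R D c (\<phi> \<theta>)"
    and "((c \<circ> \<phi>) has_vector_derivative D \<phi> \<theta> *\<^sub>R D c (\<phi> \<theta>)) (at \<theta>)"
  using vector_diff_chain_at[OF smooth_fun_D[OF assms(2)] smooth_fun_D[OF assms(1)]]
    D_eqI[of "c \<circ> \<phi>" "\<lambda>\<theta>. D \<phi> \<theta> *\<^sub>R D c (\<phi> \<theta>)"] by auto

lemma smooth_fun_compose:
  assumes "smooth_fun c" "smooth_fun \<phi>"
  shows "smooth_fun (c \<circ> \<phi>)"
  using smooth_fam_reparam[of pt "\<lambda>_ _. c" "\<lambda>_ _. \<phi>"] assms
  unfolding smooth_fun_iff_smooth_fam by (simp add: o_def)

section \<open>Diffeomorphisms of the circle and the degree\<close>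

lemma Diff_plusD:
  assumes "\<phi> \<in> Diff_plus"
  shows "smooth_fun \<phi>" "D \<phi> \<theta> > 0" "\<phi> (\<theta> + 2 * pi) = \<phi> \<theta> + 2 * pi" "strict_mono \<phi>"
    "periodic2pi (D \<phi>)" "\<phi> (2 * pi) = \<phi> 0 + 2 * pi"
proof -
  show *: "smooth_fun \<phi>" "D \<phi> \<theta> > 0" "\<phi> (\<theta> + 2 * pi) = \<phi> \<theta> + 2 * pi" for \<theta>
    using assms by (auto simp: Diff_plus_def)
  show "strict_mono \<phi>" by (rule strict_mono_of_pos_derivative[OF smooth_fun_D[OF *(1)] *(2)])
  show "\<phi> (2 * pi) = \<phi> 0 + 2 * pi" using *(3)[of 0] by simp
  \<comment> \<open>The lift itself is not periodic, but its difference from the identity is, and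
    \<open>periodic2pi_D\<close> applies to that.\<close>
  have "D \<phi> = (\<lambda>\<theta>. D (\<lambda>x. \<phi> x - x) \<theta> + 1)"
    using D_eqI[OF has_vector_derivative_diff[OF smooth_fun_D[OF *(1)] has_vector_derivative_id]]
    by (simp add: fun_eq_iff)
  moreover have "periodic2pi (D (\<lambda>x. \<phi> x - x))"
    by (rule periodic2pi_D) (simp add: periodic2pi_def *(3))
  ultimately show "periodic2pi (D \<phi>)" by (simp add: periodic2pi_def)
qed

lemma id_Diff_plus: "(\<lambda>x. x) \<in> Diff_plus"
proof -
  have "D (\<lambda>x :: real. x) = (\<lambda>_. 1)" by (rule D_eqI) simp
  moreover have "smooth_fun (\<lambda>x :: real. x)" 
    unfolding smooth_fun_iff_smooth_fam by (rule smooth_fam_theta)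
  ultimately show ?thesis by (simp add: Diff_plus_def)
qed

lemma compose_Diff_plus:
  assumes "\<phi> \<in> Diff_plus" "\<psi> \<in> Diff_plus"
  shows "\<phi> \<circ> \<psi> \<in> Diff_plus"
  using assms by (auto simp: Diff_plus_def smooth_fun_compose D_compose)

text \<open>Translation by multiples of 2 pi makes the values unbounded in both directions; the
  intermediate value theorem does the rest.\<close>

lemma Diff_plus_surj:
  assumes "\<phi> \<in> Diff_plus"
  shows "surj \<phi>"
  unfolding surj_def
proof
  fix y :: real
  have nat: "\<phi> (x + 2 * pi * of_nat m) = \<phi> x + 2 * pi * of_nat m" for x m
  proof (induction m)
    case (Suc m)
    have "\<phi> (x + 2 * pi * of_nat (Suc m)) = \<phi> ((x + 2 * pi * of_nat m) + 2 * pi)" by (simp add: algebra_simps)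
    also have "\<dots> = \<phi> x + 2 * pi * of_nat m + 2 * pi" using Diff_plusD(3)[OF assms] Suc by metis
    finally show ?case by (simp add: algebra_simps)
  qed simp
  obtain m :: nat where m: "\<bar>y - \<phi> 0\<bar> / (2 * pi) \<le> real m" using real_arch_simple by blast
  let ?a = "2 * pi * of_nat m"
  have m': "\<bar>y - \<phi> 0\<bar> \<le> ?a" using m by (simp add: divide_simps mult.commute)
  have "\<phi> (- ?a) \<le> y" "y \<le> \<phi> ?a" using nat[of "- ?a" m] nat[of 0 m] m' by auto
  then have "\<exists>x\<ge>- ?a. x \<le> ?a \<and> \<phi> x = y"
    using smooth_fun_continuous[OF Diff_plusD(1)[OF assms]]
    by (intro IVT') (auto intro: continuous_on_subset)
  then show "\<exists>x. y = \<phi> x" by blast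
qed

lemma Diff_plus_inv:
  assumes "\<phi> \<in> Diff_plus"
  shows "inv \<phi> \<in> Diff_plus" "\<phi> (inv \<phi> y) = y" "inv \<phi> (\<phi> x) = x"
    "D \<phi> (inv \<phi> y) * D (inv \<phi>) y = 1"
proof -
  note d = Diff_plusD[OF assms]
  have inj: "inj \<phi>" using d(4) by (rule strict_mono_imp_inj_on)
  show 1: "\<phi> (inv \<phi> y) = y" for y using Diff_plus_surj[OF assms] by (rule surj_f_inv_f)
  show 2: "inv \<phi> (\<phi> x) = x" for x using inj by (rule inv_f_f)
  have sm: "smooth_fun (inv \<phi>)"
    unfolding smooth_fun_iff_smooth_fam
    by (rule smooth_fam_inverse_fun[of pt "\<lambda>_ _. \<phi>"])
      (use d 1 in \<open>auto simp flip: smooth_fun_iff_smooth_fam\<close>)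
  have "\<phi> \<circ> inv \<phi> = (\<lambda>x. x)" using 1 by auto
  moreover have "D (\<lambda>x :: real. x) y = 1" for y by (subst D_eqI[of _ "\<lambda>_. 1"]) auto
  ultimately have 3: "D (inv \<phi>) y * D \<phi> (inv \<phi> y) = 1" for y
    using D_compose(1)[OF d(1) sm, of y] by simp
  then show "D \<phi> (inv \<phi> y) * D (inv \<phi>) y = 1" by (simp add: mult.commute)
  have "D (inv \<phi>) y > 0" for y
    using 3[of y] d(2)[of "inv \<phi> y"] by (metis zero_less_mult_pos2 zero_less_one)
  moreover have "inv \<phi> (y + 2 * pi) = inv \<phi> y + 2 * pi" for y
    using 2[of "inv \<phi> y + 2 * pi"] d(3) 1 by simp
  ultimately show "inv \<phi> \<in> Diff_plus" using sm by (auto simp: Diff_plus_def)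
qed

text \<open>On the level of lifts to the line, diffeomorphisms form a convex set, so every
  reparametrization is joined to the identity by a straight segment. This is the path used for
  (1).\<close>

lemma Diff_plus_convex:
  assumes \<phi>: "\<phi> \<in> Diff_plus" and \<psi>: "\<psi> \<in> Diff_plus" and t: "t \<in> {0..1}"
  shows "(\<lambda>x. (1 - t) * \<phi> x + t * \<psi> x) \<in> Diff_plus"
proof -
  have "smooth_fun (\<lambda>x. (1 - t) * \<phi> x + t * \<psi> x)"
    unfolding smooth_fun_iff_smooth_fam
    by (intro smooth_fam_add smooth_fam_mult smooth_fam_const)
      (use Diff_plusD(1)[OF \<phi>] Diff_plusD(1)[OF \<psi>] in \<open>auto simp: smooth_fun_iff_smooth_fam\<close>)
  moreover have "D (\<lambda>x. (1 - t) * \<phi> x + t * \<psi> x) = (\<lambda>x. (1 - t) * D \<phi> x + t * D \<psi> x)"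
    by (rule D_eqI) (auto intro!: derivative_eq_intros smooth_fun_D Diff_plusD(1) \<phi> \<psi>)
  moreover have "(1 - t) * D \<phi> x + t * D \<psi> x > 0" for x
  proof (cases "t = 0")
    case False
    then show ?thesis using t Diff_plusD(2)[OF \<phi>, of x] Diff_plusD(2)[OF \<psi>, of x]
      by (intro add_nonneg_pos mult_pos_pos mult_nonneg_nonneg) auto
  qed (use Diff_plusD(2)[OF \<phi>] in simp)
  ultimately show ?thesis
    using Diff_plusD(3)[OF \<phi>] Diff_plusD(3)[OF \<psi>] by (simp add: Diff_plus_def algebra_simps)
qed

text \<open>A continuous logarithm of \<open>c'\<close>.\<close>

definition lift_log :: "(real \<Rightarrow> complex) \<Rightarrow> real \<Rightarrow> complex" where
  "lift_log c \<theta> = Ln (D c 0) + prim (\<lambda>x. D (D c) x / D c x) \<theta>"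

section \<open>The degree through continuous logarithms\<close>

lemma ImmD:
  assumes "c \<in> Imm"
  shows "periodic2pi c" "smooth_fun c" "D c \<theta> \<noteq> 0"
  using assms by (auto simp: Imm_def)

lemma Imm_continuous_log_derivative:
  assumes "c \<in> Imm"
  shows "continuous_on UNIV (\<lambda>x. D (D c) x / D c x)" "periodic2pi (\<lambda>x. D (D c) x / D c x)"
proof -
  note c = ImmD[OF assms]
  show "continuous_on UNIV (\<lambda>x. D (D c) x / D c x)"
    using c by (intro continuous_intros smooth_fun_continuous_D smooth_fun_continuous_DD) auto
  show "periodic2pi (\<lambda>x. D (D c) x / D c x)"
    using periodic2pi_D[OF c(1)] periodic2pi_D[OF periodic2pi_D[OF c(1)]] by (simp add: periodic2pi_def)
qed

text \<open>The product of \<open>D c\<close> with \<open>exp (- lift_log c)\<close> has derivative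
  zero and equals 1 at 0.\<close>

lemma exp_lift_log:
  assumes c: "c \<in> Imm"
  shows "exp (lift_log c \<theta>) = D c \<theta>"
proof -
  let ?q = "\<lambda>x. D (D c) x / D c x"
  have "(lift_log c has_vector_derivative ?q x) (at x)" for x
    using has_vector_derivative_add[OF has_vector_derivative_const
      prim_has_vector_derivative[OF Imm_continuous_log_derivative(1)[OF c]]]
    by (simp add: lift_log_def[abs_def])
  then have "((\<lambda>x. exp (- lift_log c x)) has_vector_derivative (- ?q x * exp (- lift_log c x))) (at x)" for x
    by (intro field_vector_diff_chain_at[OF _ DERIV_exp, unfolded o_def] has_vector_derivative_minus)
  then have "((\<lambda>x. D c x * exp (- lift_log c x)) has_vector_derivative
      D c x * (- ?q x * exp (- lift_log c x)) + D (D c) x * exp (- lift_log c x)) (at x)" for x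
    by (intro has_vector_derivative_mult smooth_fun_DD ImmD c)
  moreover have "D c x * (- ?q x * exp (- lift_log c x)) + D (D c) x * exp (- lift_log c x) = 0" for x
    using ImmD(3)[OF c, of x] by (simp add: field_simps)
  ultimately have "((\<lambda>x. D c x * exp (- lift_log c x)) has_vector_derivative 0) (at x)" for x
    by metis
  then have "D c \<theta> * exp (- lift_log c \<theta>) = D c 0 * exp (- lift_log c 0)"
    by (rule eq_of_vector_derivative[where F = "\<lambda>x. D c x * exp (- lift_log c x)"
        and G = "\<lambda>_. D c 0 * exp (- lift_log c 0)" and f = "\<lambda>_. 0" and a = 0]) simp_all
  also have "\<dots> = 1" using ImmD(3)[OF c] by (simp add: lift_log_def exp_minus)
  finally show ?thesis by (simp add: exp_minus field_simps)
qed

text \<open>Any continuous logarithm of the velocity computes the degree; every later degree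
  computation consists in exhibiting one and reading off its increment.\<close>

lemma imm_degree_lift:
  assumes L: "continuous_on UNIV L" "\<And>\<theta>. exp (L \<theta>) = D c \<theta>"
  shows "imm_degree c = (L (2 * pi) - L 0) / (2 * of_real pi * \<i>)"
proof -
  have "path (\<lambda>t. L (2 * pi * t))"
    unfolding path_def by (intro continuous_on_compose2[OF L(1)] continuous_intros) auto
  from winding_number_compose_exp[OF this] show ?thesis
    by (simp add: imm_degree_def L(2) o_def pathfinish_def pathstart_def)
qed

lemma continuous_lift_log: "c \<in> Imm \<Longrightarrow> continuous_on UNIV (lift_log c)"
  unfolding lift_log_def[abs_def]
  by (intro continuous_intros continuous_on_prim Imm_continuous_log_derivative)

lemma Imm_k_Imm: "c \<in> Imm_k k \<Longrightarrow> c \<in> Imm"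
  by (simp add: Imm_k_def)

lemma lift_log_shift:
  assumes "c \<in> Imm_k k"
  shows "lift_log c (\<theta> + 2 * pi) = lift_log c \<theta> + 2 * of_real pi * \<i> * of_int k"
proof -
  note c = Imm_k_Imm[OF assms]
  have "lift_log c (\<theta> + 2 * pi) = lift_log c \<theta> + (lift_log c (2 * pi) - lift_log c 0)"
    using prim_periodic[OF Imm_continuous_log_derivative[OF c]] by (simp add: lift_log_def)
  also have "lift_log c (2 * pi) - lift_log c 0 = 2 * of_real pi * \<i> * of_int k"
    using imm_degree_lift[OF continuous_lift_log[OF c] exp_lift_log[OF c]] Imm_k_D(4)[OF assms]
    by (simp add: field_simps)
  finally show ?thesis .
qed

text \<open>By the chain rule a logarithm of the new velocity is \<open>ln (D \<phi>)\<close> plus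
  the old logarithm along \<open>\<phi>\<close>. The first summand is periodic, and the second has
  the old increment since \<open>\<phi>\<close> advances by 2 pi.\<close>

lemma compose_in_Imm_k:
  assumes c: "c \<in> Imm_k k" and \<phi>: "\<phi> \<in> Diff_plus"
  shows "c \<circ> \<phi> \<in> Imm_k k"
proof -
  note c' = Imm_k_D[OF c] Imm_k_Imm[OF c] and d = Diff_plusD[OF \<phi>]
  have Dc: "D (c \<circ> \<phi>) \<theta> = D \<phi> \<theta> *\<^sub>R D c (\<phi> \<theta>)" for \<theta> using D_compose c' d by blast
  let ?L = "\<lambda>\<theta>. of_real (ln (D \<phi> \<theta>)) + lift_log c (\<phi> \<theta>)"
  have "continuous_on UNIV ?L"
    using d(2) by (intro continuous_intros smooth_fun_continuous_D smooth_fun_continuous d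
      continuous_on_compose2[OF continuous_lift_log[OF c'(5)]]) (auto simp: less_imp_neq[symmetric])
  moreover have "exp (?L \<theta>) = D (c \<circ> \<phi>) \<theta>" for \<theta>
    using d(2)[of \<theta>] by (simp add: exp_add exp_lift_log[OF c'(5)] Dc scaleR_conv_of_real exp_of_real)
  ultimately have "imm_degree (c \<circ> \<phi>) = (?L (2 * pi) - ?L 0) / (2 * of_real pi * \<i>)"
    by (rule imm_degree_lift)
  also have "\<dots> = of_int k"
  proof -
    have "D \<phi> (2 * pi) = D \<phi> 0" using d(5) unfolding periodic2pi_def by (metis add_0)
    then show ?thesis by (simp add: d(6) lift_log_shift[OF c])
  qed
  finally show ?thesis
    using c' d less_imp_neq[OF d(2)] by (auto simp: Imm_k_def Imm_def periodic2pi_def Dc smooth_fun_compose)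
qed

section \<open>The flow towards the circle of round curves\<close>

text \<open>Write \<open>c' = |c'| exp(i \<alpha>)\<close> with a continuous angle \<open>\<alpha>\<close>. The function \<open>dev k c\<close> is
  \<open>\<alpha> - k arclen c\<close> up to a constant, hence periodic; \<open>utan k t c\<close> is the unit tangent with
  angle moved linearly towards \<open>k arclen c + const\<close>, a formula that does not depend on the choice of \<open>\<alpha>\<close>.
  Subtracting the mean in \<open>vel\<close> closes the curve up again. The base point in \<open>flow\<close> is fixed through
  the centre of mass, which, unlike the value at \<open>0\<close>, is invariant under reparametrization.\<close>

definition spd :: "(real \<Rightarrow> complex) \<Rightarrow> real \<Rightarrow> real" where
  "spd c \<theta> = norm (D c \<theta>)"

definition len :: "(real \<Rightarrow> complex) \<Rightarrow> real" where
  "len c = prim (spd c) (2 * pi)"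

definition arclen :: "(real \<Rightarrow> complex) \<Rightarrow> real \<Rightarrow> real" where
  "arclen c \<theta> = 2 * pi / len c * prim (spd c) \<theta>"

text \<open>The mean with respect to the arc length measure, which, unlike the measure of the
  parameter, is transported by reparametrization.\<close>

definition cmean :: "(real \<Rightarrow> complex) \<Rightarrow> (real \<Rightarrow> 'a::euclidean_space) \<Rightarrow> 'a" where
  "cmean c f = (1 / len c) *\<^sub>R prim (\<lambda>\<theta>. spd c \<theta> *\<^sub>R f \<theta>) (2 * pi)"

definition dev :: "int \<Rightarrow> (real \<Rightarrow> complex) \<Rightarrow> real \<Rightarrow> real" where
  "dev k c \<theta> = prim (\<lambda>\<theta>. Im (D (D c) \<theta> / D c \<theta>)) \<theta> - of_int k * arclen c \<theta>"

definition utan :: "int \<Rightarrow> real \<Rightarrow> (real \<Rightarrow> complex) \<Rightarrow> real \<Rightarrow> complex" where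
  "utan k t c \<theta> = D c \<theta> / of_real (spd c \<theta>) * exp (\<i> * of_real (t * (cmean c (dev k c) - dev k c \<theta>)))"

text \<open>The factor \<open>2 * pi / len c * spd c \<theta>\<close> is the derivative of
  \<open>arclen c\<close>. The remaining scalar runs from \<open>len c / (2 * pi)\<close>, the mean
  speed of \<open>c\<close>, to 1, the speed of the round curves.\<close>

definition vel :: "int \<Rightarrow> real \<Rightarrow> (real \<Rightarrow> complex) \<Rightarrow> real \<Rightarrow> complex" where
  "vel k t c \<theta> = (((1 - t) * (len c / (2 * pi)) + t) * (2 * pi / len c) * spd c \<theta>) *\<^sub>R
     (utan k t c \<theta> - cmean c (utan k t c))"

text \<open>The centre of mass over the arc length of \<open>c\<close> moves linearly to the origin,
  where the round curves \<open>e_curve\<close> have theirs.\<close>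

definition flow :: "int \<Rightarrow> real \<Rightarrow> (real \<Rightarrow> complex) \<Rightarrow> real \<Rightarrow> complex" where
  "flow k t c \<theta> = prim (vel k t c) \<theta> - cmean c (prim (vel k t c)) + (1 - t) *\<^sub>R cmean c c"

lemma spd_pos: "c \<in> Imm \<Longrightarrow> spd c \<theta> > 0"
  using ImmD(3) by (simp add: spd_def)

lemma continuous_spd: "c \<in> Imm \<Longrightarrow> continuous_on UNIV (spd c)"
  unfolding spd_def[abs_def] by (intro continuous_intros smooth_fun_continuous_D ImmD)

lemma periodic_spd: "c \<in> Imm \<Longrightarrow> periodic2pi (spd c)"
  using periodic2pi_D[OF ImmD(1)] by (simp add: spd_def periodic2pi_def)

lemma len_pos:
  assumes "c \<in> Imm"
  shows "len c > 0"
proof -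
  have "strict_mono (prim (spd c))"
    by (rule strict_mono_of_pos_derivative[OF prim_has_vector_derivative[OF continuous_spd[OF assms]]
          spd_pos[OF assms]])
  from strict_monoD[OF this, of 0 "2 * pi"] show ?thesis by (simp add: len_def)
qed

section \<open>Smooth dependence of the ingredients of the flow\<close>

context
  fixes P :: "'p topology" and T :: "'p \<Rightarrow> real \<Rightarrow> real \<Rightarrow> complex"
  assumes T: "smooth_fam P T" and im: "\<And>p s. p \<in> topspace P \<Longrightarrow> T p s \<in> Imm"
begin

lemma smooth_fam_spd: "smooth_fam P (\<lambda>p s \<theta>. spd (T p s) \<theta>)"
  unfolding spd_def by (intro smooth_fam_norm smooth_fam_D T ImmD(3) im)

lemma smooth_fam_len: "smooth_fam P (\<lambda>p s \<theta>. len (T p s))"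
  unfolding len_def by (rule smooth_fam_eval[OF smooth_fam_prim[OF smooth_fam_spd]])

lemma len_nonzero: "p \<in> topspace P \<Longrightarrow> len (T p s) \<noteq> 0"
  using len_pos[OF im] by (metis less_irrefl)

lemma smooth_fam_arclen: "smooth_fam P (\<lambda>p s \<theta>. arclen (T p s) \<theta>)"
  unfolding arclen_def
  by (intro smooth_fam_mult smooth_fam_divide smooth_fam_const smooth_fam_len
    smooth_fam_prim smooth_fam_spd len_nonzero)

lemma smooth_fam_cmean:
  fixes G :: "'p \<Rightarrow> real \<Rightarrow> real \<Rightarrow> 'a::euclidean_space"
  assumes "smooth_fam P G"
  shows "smooth_fam P (\<lambda>p s \<theta>. cmean (T p s) (G p s))"
  unfolding cmean_def
  by (intro smooth_fam_scaleR smooth_fam_divide smooth_fam_const smooth_fam_len len_nonzero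
    smooth_fam_eval[OF smooth_fam_prim[OF smooth_fam_scaleR[OF smooth_fam_spd assms]]])

lemma smooth_fam_dev: "smooth_fam P (\<lambda>p s \<theta>. dev k (T p s) \<theta>)"
  unfolding dev_def
  by (intro smooth_fam_diff smooth_fam_mult smooth_fam_const smooth_fam_arclen smooth_fam_prim
    smooth_fam_Im smooth_fam_divide smooth_fam_D T ImmD(3) im)

context
  fixes t :: "'p \<Rightarrow> real \<Rightarrow> real"
  assumes t: "smooth_fam P (\<lambda>p s \<theta>. t p s)"
begin

lemma smooth_fam_utan: "smooth_fam P (\<lambda>p s \<theta>. utan k (t p s) (T p s) \<theta>)"
  unfolding utan_def
  by (intro smooth_fam_mult smooth_fam_exp smooth_fam_of_real smooth_fam_divide smooth_fam_const
      smooth_fam_diff smooth_fam_dev smooth_fam_cmean[OF smooth_fam_dev] smooth_fam_D T t smooth_fam_spd)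
    (use spd_pos[OF im] in \<open>metis less_irrefl of_real_eq_0_iff\<close>)

lemma smooth_fam_vel: "smooth_fam P (\<lambda>p s \<theta>. vel k (t p s) (T p s) \<theta>)"
  unfolding vel_def
  by (intro smooth_fam_scaleR smooth_fam_mult smooth_fam_add smooth_fam_divide smooth_fam_const
      smooth_fam_diff smooth_fam_utan smooth_fam_cmean[OF smooth_fam_utan] smooth_fam_len t smooth_fam_spd len_nonzero)
    auto

lemma smooth_fam_flow: "smooth_fam P (\<lambda>p s \<theta>. flow k (t p s) (T p s) \<theta>)"
  unfolding flow_def
  by (intro smooth_fam_scaleR smooth_fam_add smooth_fam_const smooth_fam_diff T t
      smooth_fam_prim[OF smooth_fam_vel] smooth_fam_cmean smooth_fam_cmean[OF T])

end
end

section \<open>Arc length and means of one immersion\<close>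

context
  fixes c :: "real \<Rightarrow> complex"
  assumes c: "c \<in> Imm"
begin

lemma smooth_fam_Imm: "smooth_fam pt (\<lambda>_ _. c)"
  using ImmD(2)[OF c] by (simp add: smooth_fun_iff_smooth_fam)

lemma smooth_arclen: "smooth_fun (arclen c)"
  and smooth_dev: "smooth_fun (dev k c)"
  and smooth_utan: "smooth_fun (utan k t c)"
  and smooth_vel: "smooth_fun (vel k t c)"
  and smooth_flow: "smooth_fun (flow k t c)"
  using smooth_fam_arclen[OF smooth_fam_Imm] smooth_fam_dev[OF smooth_fam_Imm]
    smooth_fam_utan[OF smooth_fam_Imm _ smooth_fam_const] smooth_fam_vel[OF smooth_fam_Imm _ smooth_fam_const]
    smooth_fam_flow[OF smooth_fam_Imm _ smooth_fam_const] c
  by (simp_all add: smooth_fun_iff_smooth_fam)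

lemma arclen_has_vector_derivative: "(arclen c has_vector_derivative (2 * pi / len c * spd c \<theta>)) (at \<theta>)"
  unfolding arclen_def[abs_def]
  using bounded_linear.has_vector_derivative[OF bounded_linear_mult_right
      prim_has_vector_derivative[OF continuous_spd[OF c]]] .

lemma D_arclen: "D (arclen c) = (\<lambda>\<theta>. 2 * pi / len c * spd c \<theta>)"
  by (rule D_eqI[OF arclen_has_vector_derivative])

lemma arclen_Diff_plus: "arclen c \<in> Diff_plus"
proof -
  have "arclen c (\<theta> + 2 * pi) = 2 * pi / len c * (prim (spd c) \<theta> + len c)" for \<theta>
    using prim_periodic[OF continuous_spd periodic_spd, OF c c] by (simp only: arclen_def len_def)
  then have "arclen c (\<theta> + 2 * pi) = arclen c \<theta> + 2 * pi" for \<theta>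
    using len_pos[OF c] by (simp add: arclen_def distrib_left)
  then show ?thesis
    using smooth_arclen len_pos[OF c] spd_pos[OF c] by (simp add: Diff_plus_def D_arclen)
qed

lemma continuous_cmean_integrand:
  fixes f :: "real \<Rightarrow> 'a::real_normed_vector"
  shows "continuous_on UNIV f \<Longrightarrow> continuous_on UNIV (\<lambda>\<theta>. spd c \<theta> *\<^sub>R f \<theta>)"
  by (intro continuous_intros continuous_spd c)

lemma cmean_diff:
  assumes "continuous_on UNIV f" "continuous_on UNIV g"
  shows "cmean c (\<lambda>x. f x - g x) = cmean c f - cmean c g"
  unfolding cmean_def scaleR_diff_right
  by (subst prim_diff) (auto simp: scaleR_diff_right intro: continuous_cmean_integrand assms)

lemma cmean_const: "cmean c (\<lambda>x. a) = a"
proof -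
  have "prim (\<lambda>x. spd c x *\<^sub>R a) (2 * pi) = prim (spd c) (2 * pi) *\<^sub>R a"
    by (rule prim_linear[OF bounded_linear_scaleR_left continuous_spd[OF c]])
  then show ?thesis using len_pos[OF c] by (simp add: cmean_def len_def[symmetric])
qed

lemma cmean_linear:
  assumes "bounded_linear h" "continuous_on UNIV f"
  shows "cmean c (\<lambda>x. h (f x)) = h (cmean c f)"
  using prim_linear[OF assms(1) continuous_cmean_integrand[OF assms(2)], of "2 * pi"]
    bounded_linear.linear[OF assms(1)] by (simp add: cmean_def linear_scale)

text \<open>The equality case of the triangle inequality for integrals. With \<open>e\<close> the
  direction of the mean \<open>m\<close>, the nonnegative function
  \<open>spd c * (1 - e \<bullet> u)\<close> has integral \<open>len c * (1 - norm m)\<close>. If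
  this is not positive, the function vanishes and \<open>u\<close> is constantly
  \<open>e\<close>.\<close>

lemma norm_cmean_less_1:
  fixes u :: "real \<Rightarrow> complex"
  assumes u: "continuous_on UNIV u" "\<And>\<theta>. norm (u \<theta>) = 1"
    and ab: "a \<in> {0..2 * pi}" "b \<in> {0..2 * pi}" "u a \<noteq> u b"
  shows "norm (cmean c u) < 1"
proof (rule ccontr)
  define m where "m = cmean c u"
  assume "\<not> norm (cmean c u) < 1"
  then have m1: "norm m \<ge> 1" by (simp add: m_def)
  define e where "e = sgn m"
  have e: "norm e = 1" using m1 by (auto simp: e_def norm_sgn)
  have "m \<noteq> 0" using m1 by auto
  then have em: "e \<bullet> m = norm m"
    by (simp add: e_def sgn_div_norm power2_norm_eq_inner[symmetric] power2_eq_square)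
  define f where "f \<theta> = spd c \<theta> * (1 - e \<bullet> u \<theta>)" for \<theta>
  have cf: "continuous_on UNIV f"
    unfolding f_def by (intro continuous_intros continuous_spd u c)
  have f0: "f \<theta> \<ge> 0" for \<theta>
    using Cauchy_Schwarz_ineq2[of e "u \<theta>"] e u(2)[of \<theta>] spd_pos[OF c, of \<theta>]
    by (auto simp: f_def intro!: mult_nonneg_nonneg)
  have dF: "(prim f has_vector_derivative f x) (at x)" for x by (rule prim_has_vector_derivative[OF cf])
  have "cmean c (\<lambda>\<theta>. 1 - e \<bullet> u \<theta>) = 1 - e \<bullet> m"
    using cmean_diff[of "\<lambda>_. 1" "\<lambda>\<theta>. e \<bullet> u \<theta>"] cmean_const[of "1 :: real"]
      cmean_linear[OF bounded_linear_inner_right u(1), of e] u(1)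
    by (simp add: m_def continuous_intros)
  then have "prim f (2 * pi) = len c * (1 - norm m)"
    using len_pos[OF c] em unfolding cmean_def f_def[abs_def] by (simp add: field_simps)
  then have F1: "prim f (2 * pi) \<le> 0" using m1 len_pos[OF c] by (simp add: mult_le_0_iff)
  have mono: "prim f x \<le> prim f y" if "x \<le> y" for x y
    using that
    by (rule DERIV_nonneg_imp_nondecreasing)
      (use f0 dF in \<open>unfold has_real_derivative_iff_has_vector_derivative, blast\<close>)
  have prim0: "prim f x = 0" if "x \<in> {0..2 * pi}" for x
    using mono[of 0 x] mono[of x "2 * pi"] F1 that by auto
  \<comment> \<open>The primitive is known to vanish only on the closed interval, so derivatives
    within it are compared; this includes the end points, where \<open>a\<close> or \<open>b\<close>
    may lie.\<close>
  have f_0: "f x = 0" if x: "x \<in> {0..2 * pi}" for x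
  proof (rule vector_derivative_unique_within_closed_interval[of 0 "2 * pi" x "prim f"])
    show "(prim f has_vector_derivative f x) (at x within cbox 0 (2 * pi))"
      using dF by (rule has_vector_derivative_at_within)
    show "(prim f has_vector_derivative 0) (at x within cbox 0 (2 * pi))"
      unfolding cbox_interval
      by (rule has_vector_derivative_transform[OF x prim0 has_vector_derivative_const])
  qed (use x in auto)
  have "u x = e" if "x \<in> {0..2 * pi}" for x
  proof -
    have "e \<bullet> u x = 1" using f_0[OF that] spd_pos[OF c, of x] by (simp add: f_def)
    moreover have "u x \<bullet> u x = 1" "e \<bullet> e = 1" using u(2)[of x] e by (simp_all add: dot_square_norm)
    ultimately have "(norm (u x - e))\<^sup>2 = 0"
      by (simp add: power2_norm_eq_inner inner_diff inner_commute)
    then show ?thesis by simp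
  qed
  with ab show False by metis
qed

end

section \<open>The interpolated unit tangents and the degree of the flow\<close>

context
  fixes c :: "real \<Rightarrow> complex" and k :: int
  assumes ck: "c \<in> Imm_k k"
begin

private lemma c: "c \<in> Imm"
  using ck by (rule Imm_k_Imm)

lemma Im_lift_log: "Im (lift_log c \<theta>) = Im (Ln (D c 0)) + dev k c \<theta> + of_int k * arclen c \<theta>"
  using prim_linear[OF bounded_linear_Im Imm_continuous_log_derivative(1)[OF c], of \<theta>]
  by (simp add: lift_log_def dev_def)

text \<open>Over one period the tangent angle and \<open>of_int k * arclen c\<close> both grow by 2
  pi k; this is where the degree of \<open>c\<close> enters.\<close>

lemma dev_shift: "dev k c (\<theta> + 2 * pi) = dev k c \<theta>"
proof -
  have "Im (lift_log c (\<theta> + 2 * pi)) = Im (lift_log c \<theta>) + 2 * pi * of_int k"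
    by (simp add: lift_log_shift[OF ck])
  then show ?thesis using Diff_plusD(3)[OF arclen_Diff_plus[OF c]] unfolding Im_lift_log by (simp add: algebra_simps)
qed

text \<open>A continuous angle for \<open>utan k t c\<close>. At \<open>t = 1\<close> the deviation
  cancels and what remains is \<open>of_int k * arclen c\<close> plus a constant.\<close>

definition utan_angle :: "real \<Rightarrow> real \<Rightarrow> real" where
  "utan_angle t \<theta> = Im (lift_log c \<theta>) + t * (cmean c (dev k c) - dev k c \<theta>)"

lemma utan_eq_exp: "utan k t c \<theta> = exp (\<i> * of_real (utan_angle t \<theta>))"
proof -
  have "D c \<theta> / of_real (spd c \<theta>) = exp (lift_log c \<theta>) / of_real (exp (Re (lift_log c \<theta>)))"
    by (simp add: spd_def exp_lift_log[OF c, symmetric])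
  also have "\<dots> = exp (lift_log c \<theta> - of_real (Re (lift_log c \<theta>)))" by (simp add: exp_diff exp_of_real)
  also have "lift_log c \<theta> - of_real (Re (lift_log c \<theta>)) = \<i> * of_real (Im (lift_log c \<theta>))"
    by (simp add: complex_eq_iff)
  finally show ?thesis by (simp add: utan_def utan_angle_def exp_add[symmetric] distrib_left)
qed

lemma norm_utan: "norm (utan k t c \<theta>) = 1"
  by (simp add: utan_eq_exp)

lemma utan_angle_shift: "utan_angle t (\<theta> + 2 * pi) = utan_angle t \<theta> + 2 * pi * of_int k"
  by (simp add: utan_angle_def dev_shift lift_log_shift[OF ck])

lemma continuous_utan_angle: "continuous_on UNIV (utan_angle t)"
  unfolding utan_angle_def[abs_def]
  by (intro continuous_intros continuous_lift_log c smooth_fun_continuous smooth_dev)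

lemma periodic_utan: "periodic2pi (utan k t c)"
proof -
  have "exp (\<i> * of_real (2 * pi * of_int k)) = 1"
    using exp_two_pi_i exp_eq_1 by (simp add: exp_eq_1)
  then show ?thesis by (simp add: periodic2pi_def utan_eq_exp utan_angle_shift distrib_left exp_add)
qed

text \<open>The angle of the unit tangent increases by \<open>2 \<pi> k \<noteq> 0\<close>, so the unit tangent takes two
  opposite values.\<close>

lemma norm_cmean_utan_less_1:
  assumes k: "k \<noteq> 0"
  shows "norm (cmean c (utan k t c)) < 1"
proof -
  let ?A = "utan_angle t"
  have cA: "continuous_on {0..2 * pi} ?A" using continuous_utan_angle by (rule continuous_on_subset) simp
  have A2: "?A (2 * pi) = ?A 0 + 2 * pi * of_int k" using utan_angle_shift[of t 0] by simp
  \<comment> \<open>Half a turn in the direction of \<open>k\<close> lies within the total increment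
    2 pi k because |k| is at least 1.\<close>
  have "\<exists>b\<in>{0..2 * pi}. ?A b = ?A 0 + pi * sgn (of_int k)"
  proof (cases "k > 0")
    case True
    then have "of_int k \<ge> (1 :: real)" by linarith
    then have "pi * 1 \<le> 2 * pi * of_int k" by simp
    then have "\<exists>b\<ge>0. b \<le> 2 * pi \<and> ?A b = ?A 0 + pi"
      using cA A2 by (intro IVT') auto
    then show ?thesis using True by auto
  next
    case False
    then have "of_int k \<le> (-1 :: real)" using k by linarith
    then have "2 * pi * of_int k \<le> 2 * pi * (-1)" by (intro mult_left_mono) auto
    then have "2 * pi * of_int k \<le> - pi" using pi_gt_zero by linarith
    then have "\<exists>b\<ge>0. b \<le> 2 * pi \<and> ?A b = ?A 0 - pi"
      using cA A2 by (intro IVT2') auto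
    then show ?thesis using False k by auto
  qed
  then obtain b where b: "b \<in> {0..2 * pi}" "?A b = ?A 0 + pi * sgn (of_int k)" by blast
  have "exp (\<i> * of_real (pi * sgn (of_int k))) = (-1 :: complex)"
    using k by (auto simp: sgn_if exp_minus)
  then have "utan k t c b = - utan k t c 0"
    unfolding utan_eq_exp b(2) of_real_add distrib_left exp_add by simp
  moreover have "utan k t c 0 \<noteq> 0" using norm_utan[of t 0] by auto
  ultimately show ?thesis
    using norm_cmean_less_1[OF c smooth_fun_continuous[OF smooth_utan[OF c]] norm_utan, of 0 b] b(1) by auto
qed

lemma continuous_vel: "continuous_on UNIV (vel k t c)"
  by (rule smooth_fun_continuous[OF smooth_vel[OF c]])

lemma continuous_utan: "continuous_on UNIV (utan k t c)"
  by (rule smooth_fun_continuous[OF smooth_utan[OF c]])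

lemma D_flow: "D (flow k t c) = vel k t c"
proof (rule D_eqI)
  show "(flow k t c has_vector_derivative vel k t c \<theta>) (at \<theta>)" for \<theta>
    using has_vector_derivative_add[OF has_vector_derivative_diff[OF
        prim_has_vector_derivative[OF continuous_vel] has_vector_derivative_const] has_vector_derivative_const]
    by (simp add: flow_def[abs_def])
qed

lemma periodic_vel: "periodic2pi (vel k t c)"
  using periodic_utan periodic_spd[OF c] by (simp add: periodic2pi_def vel_def)

text \<open>Up to a factor independent of \<open>\<theta>\<close>, \<open>vel\<close> is
  \<open>spd c\<close> times a function of arc length mean zero, so its integral over a period
  vanishes.\<close>

lemma periodic_flow: "periodic2pi (flow k t c)"
proof -
  let ?u = "utan k t c"
  have "cmean c (\<lambda>x. ?u x - cmean c ?u) = 0"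
    by (subst cmean_diff[OF c continuous_utan]) (simp_all add: cmean_const[OF c])
  then have 0: "prim (\<lambda>x. spd c x *\<^sub>R (?u x - cmean c ?u)) (2 * pi) = 0"
    using len_pos[OF c] by (simp add: cmean_def)
  let ?r = "((1 - t) * (len c / (2 * pi)) + t) * (2 * pi / len c)"
  have "vel k t c = (\<lambda>x. ?r *\<^sub>R (spd c x *\<^sub>R (?u x - cmean c ?u)))"
    by (simp add: vel_def[abs_def])
  then have "prim (vel k t c) (2 * pi) = ?r *\<^sub>R prim (\<lambda>x. spd c x *\<^sub>R (?u x - cmean c ?u)) (2 * pi)"
    by (simp only:) (rule prim_scaleR, intro continuous_cmean_integrand[OF c] continuous_intros continuous_utan)
  then have "prim (vel k t c) (2 * pi) = 0" by (simp add: 0)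
  then show ?thesis
    using prim_periodic[OF continuous_vel periodic_vel] by (simp add: periodic2pi_def flow_def)
qed

text \<open>The velocity factors as a positive function \<open>?\<rho>\<close> times the unit
  tangent times \<open>?w\<close>, obtained by pulling the unit tangent out of \<open>u - m\<close>.
  Since |m| < 1, \<open>?w\<close> has positive real part, so its principal logarithm is continuous
  and periodic. In the sum of the three logarithms only the angle has a net increment, namely 2 pi
  k.\<close>

lemma flow_in_Imm_k:
  assumes k: "k \<noteq> 0" and t: "t \<in> {0..1}"
  shows "flow k t c \<in> Imm_k k"
proof -
  let ?u = "utan k t c" and ?m = "cmean c (utan k t c)"
  let ?\<rho> = "\<lambda>\<theta>. ((1 - t) * (len c / (2 * pi)) + t) * (2 * pi / len c) * spd c \<theta>"
  let ?w = "\<lambda>\<theta>. 1 - ?m * exp (- (\<i> * of_real (utan_angle t \<theta>)))"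
  have len: "len c > 0" by (rule len_pos[OF c])
  have "(1 - t) * (len c / (2 * pi)) + t > 0"
  proof (cases "t = 0")
    case False
    then show ?thesis using t len by (intro add_nonneg_pos mult_nonneg_nonneg) auto
  qed (use len in simp)
  then have \<rho>: "?\<rho> \<theta> > 0" for \<theta> using len spd_pos[OF c] by (intro mult_pos_pos divide_pos_pos) auto
  have "norm (?m * exp (- (\<i> * of_real (utan_angle t \<theta>)))) < 1" for \<theta>
    using norm_cmean_utan_less_1[OF k, of t] by (simp add: norm_mult)
  then have "Re (?m * exp (- (\<i> * of_real (utan_angle t \<theta>)))) < 1" for \<theta>
    using complex_Re_le_cmod le_less_trans by blast
  then have w: "Re (?w \<theta>) > 0" for \<theta> by simp
  then have w': "?w \<theta> \<notin> \<real>\<^sub>\<le>\<^sub>0" for \<theta> using complex_nonpos_Reals_iff by (metis not_less)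
  have w0: "?w \<theta> \<noteq> 0" for \<theta> using w[of \<theta>] by (metis less_irrefl zero_complex.simps(1))
  let ?L = "\<lambda>\<theta>. of_real (ln (?\<rho> \<theta>)) + \<i> * of_real (utan_angle t \<theta>) + Ln (?w \<theta>)"
  have vel: "vel k t c \<theta> = exp (?L \<theta>)" for \<theta>
  proof -
    have "exp (?L \<theta>) = of_real (?\<rho> \<theta>) * ?u \<theta> * ?w \<theta>"
      using \<rho>[of \<theta>] by (simp only: exp_add exp_Ln[OF w0] utan_eq_exp exp_of_real exp_ln)
    also have "\<dots> = of_real (?\<rho> \<theta>) * (?u \<theta> * ?w \<theta>)" by (rule mult.assoc)
    also have "?u \<theta> * ?w \<theta> = ?u \<theta> - ?m"
      by (simp add: utan_eq_exp exp_minus right_diff_distrib)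
    finally show ?thesis by (simp add: vel_def scaleR_conv_of_real)
  qed
  have "continuous_on UNIV ?L"
    using w' by (intro continuous_intros continuous_spd[OF c] continuous_utan_angle)
      (use \<rho> in \<open>metis less_irrefl\<close>)
  then have "imm_degree (flow k t c) = (?L (2 * pi) - ?L 0) / (2 * of_real pi * \<i>)"
    by (rule imm_degree_lift) (simp add: vel D_flow)
  also have "\<dots> = of_int k"
  proof -
    have 1: "spd c (2 * pi) = spd c 0"
      using periodic_spd[OF c] unfolding periodic2pi_def by (metis add_0)
    have 2: "exp (\<i> * of_real (utan_angle t (2 * pi))) = exp (\<i> * of_real (utan_angle t 0))"
      using periodic_utan[of t] unfolding periodic2pi_def by (metis add_0 utan_eq_exp)
    have 3: "exp (- (\<i> * of_real (utan_angle t (2 * pi)))) = exp (- (\<i> * of_real (utan_angle t 0)))"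
      unfolding exp_minus 2 ..
    have "?L (2 * pi) - ?L 0 = \<i> * of_real (utan_angle t (2 * pi)) - \<i> * of_real (utan_angle t 0)"
      unfolding 1 3 by simp
    also have "\<dots> = 2 * of_real pi * \<i> * of_int k"
      using utan_angle_shift[of t 0] by (simp add: algebra_simps)
    finally show ?thesis by simp
  qed
  finally show ?thesis
    using periodic_flow smooth_flow[OF c] by (simp add: Imm_k_def Imm_def D_flow vel)
qed

end

section \<open>Round curves and curves of constant speed\<close>

lemma e_curve_has_vector_derivative:
  assumes "k \<noteq> 0"
  shows "(e_curve k \<alpha> has_vector_derivative \<alpha> * exp (\<i> * of_int k * of_real x)) (at x)"
proof -
  have "((\<lambda>z. \<alpha> * exp (\<i> * of_int k * z) / (\<i> * of_int k)) has_field_derivative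
      \<alpha> * exp (\<i> * of_int k * of_real x)) (at (of_real x))"
    using assms by (auto intro!: derivative_eq_intros)
  from has_vector_derivative_real_field[OF this] show ?thesis
    by (simp add: e_curve_def[abs_def])
qed

lemma D_e_curve: "k \<noteq> 0 \<Longrightarrow> D (e_curve k \<alpha>) = (\<lambda>x. \<alpha> * exp (\<i> * of_int k * of_real x))"
  by (rule D_eqI[OF e_curve_has_vector_derivative])

lemma exp_int_shift: "exp (\<i> * of_int k * of_real (x + 2 * pi)) = exp (\<i> * of_int k * of_real x)"
proof -
  have "exp (\<i> * of_int k * of_real (2 * pi)) = 1"
    by (auto simp: exp_eq_1)
  then show ?thesis by (simp add: distrib_left exp_add)
qed

lemma periodic_e_curve: "periodic2pi (e_curve k \<alpha>)"
  unfolding periodic2pi_def e_curve_def exp_int_shift by simp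

lemma smooth_e_curve: "smooth_fun (e_curve k \<alpha>)"
  unfolding smooth_fun_iff_smooth_fam e_curve_def divide_inverse
  by (intro smooth_fam_mult smooth_fam_exp smooth_fam_const smooth_fam_of_real smooth_fam_theta)

lemma e_curve_in_Imm_k:
  assumes k: "k \<noteq> 0" and \<alpha>: "norm \<alpha> = 1"
  shows "e_curve k \<alpha> \<in> Imm_k k"
proof -
  let ?L = "\<lambda>x. Ln \<alpha> + \<i> * of_int k * of_real x"
  have 0: "\<alpha> \<noteq> 0" using \<alpha> by auto
  have "imm_degree (e_curve k \<alpha>) = (?L (2 * pi) - ?L 0) / (2 * of_real pi * \<i>)"
    by (rule imm_degree_lift) (use 0 in \<open>auto intro!: continuous_intros simp: D_e_curve[OF k] exp_add\<close>)
  also have "\<dots> = of_int k" by simp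
  finally show ?thesis
    using 0 by (simp add: Imm_k_def Imm_def periodic_e_curve smooth_e_curve D_e_curve[OF k])
qed

lemma spd_e_curve: "k \<noteq> 0 \<Longrightarrow> norm \<alpha> = 1 \<Longrightarrow> spd (e_curve k \<alpha>) = (\<lambda>_. 1)"
  by (simp add: spd_def[abs_def] D_e_curve norm_mult)

text \<open>Because \<open>arclen\<close> is normalized to vanish at 0, it is exactly the identity
  on such curves and not merely a rotation. This keeps them pointwise fixed under reparametrization
  by arc length.\<close>

lemma constant_speed:
  assumes "c \<in> Imm_a k"
  shows "arclen c = (\<lambda>x. x)" "c \<in> Imm_k k" "\<And>x. spd c x = len c / (2 * pi)"
proof -
  obtain r where r: "spd c = (\<lambda>_. r)" and c: "c \<in> Imm_k k"
    using assms by (auto simp: Imm_a_def spd_def[abs_def])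
  have "len c = 2 * pi * r" by (simp add: len_def r prim_const)
  moreover have "r \<noteq> 0" using spd_pos[OF Imm_k_Imm[OF c]] r by (metis less_irrefl)
  ultimately show "arclen c = (\<lambda>x. x)" "\<And>x. spd c x = len c / (2 * pi)"
    by (simp_all add: arclen_def[abs_def] r prim_const)
qed (use assms in \<open>simp add: Imm_a_def\<close>)

lemma e_circle_subset_Imm_a: "k \<noteq> 0 \<Longrightarrow> e_circle k \<subseteq> Imm_a k"
  using e_curve_in_Imm_k by (auto simp: e_circle_def Imm_a_def D_e_curve norm_mult)

section \<open>The two ends of the flow\<close>

context
  fixes c :: "real \<Rightarrow> complex" and k :: int
  assumes ck: "c \<in> Imm_k k"
begin

private lemma c_Imm: "c \<in> Imm"
  using ck by (rule Imm_k_Imm)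

text \<open>Weighted by the derivative of \<open>arclen c\<close>, the first integrand is the
  derivative of the periodic function \<open>e_curve k \<alpha> \<circ> arclen c\<close>, so it
  integrates to zero. The second is the first with \<open>\<alpha>\<close> divided by ik.\<close>

lemma cmean_e_curve_arclen:
  assumes k: "k \<noteq> 0"
  shows "cmean c (\<lambda>\<theta>. \<alpha> * exp (\<i> * of_int k * of_real (arclen c \<theta>))) = 0"
    and "cmean c (\<lambda>\<theta>. e_curve k \<alpha> (arclen c \<theta>)) = 0"
proof -
  have len: "len c > 0" by (rule len_pos[OF c_Imm])
  have mean_0: "cmean c (\<lambda>\<theta>. \<alpha> * exp (\<i> * of_int k * of_real (arclen c \<theta>))) = 0" for \<alpha>
  proof -
    let ?f = "\<lambda>\<theta>. (2 * pi / len c * spd c \<theta>) *\<^sub>R (\<alpha> * exp (\<i> * of_int k * of_real (arclen c \<theta>)))"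
    have cf: "continuous_on UNIV ?f"
      by (intro continuous_intros continuous_spd c_Imm smooth_fun_continuous smooth_arclen)
    have "((\<lambda>\<theta>. e_curve k \<alpha> (arclen c \<theta>)) has_vector_derivative ?f \<theta>) (at \<theta>)" for \<theta>
      using vector_diff_chain_at[OF arclen_has_vector_derivative[OF c_Imm] e_curve_has_vector_derivative[OF k]]
      by (simp add: o_def)
    then have "prim ?f (2 * pi) = e_curve k \<alpha> (arclen c (2 * pi)) - e_curve k \<alpha> (arclen c 0)"
      by (rule prim_unique[OF _ cf])
    also have "\<dots> = 0"
      using Diff_plusD(6)[OF arclen_Diff_plus[OF c_Imm]] periodic_e_curve[of k \<alpha>] by (simp add: periodic2pi_def)
    finally have "prim ?f (2 * pi) = 0" .
    moreover have "?f = (\<lambda>\<theta>. (2 * pi / len c) *\<^sub>R (spd c \<theta> *\<^sub>R (\<alpha> * exp (\<i> * of_int k * of_real (arclen c \<theta>)))))"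
      by simp
    ultimately have "(2 * pi / len c) *\<^sub>R prim (\<lambda>\<theta>. spd c \<theta> *\<^sub>R (\<alpha> * exp (\<i> * of_int k * of_real (arclen c \<theta>)))) (2 * pi) = 0"
      by (subst prim_scaleR[symmetric])
        (simp_all only:, intro continuous_intros continuous_spd c_Imm smooth_fun_continuous smooth_arclen)
    then show ?thesis using len by (simp add: cmean_def)
  qed
  then show "cmean c (\<lambda>\<theta>. \<alpha> * exp (\<i> * of_int k * of_real (arclen c \<theta>))) = 0" .
  show "cmean c (\<lambda>\<theta>. e_curve k \<alpha> (arclen c \<theta>)) = 0"
    using mean_0[of "\<alpha> / (\<i> * of_int k)"] by (simp add: e_curve_def)
qed

text \<open>At \<open>t = 0\<close> the product of speed and unit tangent is \<open>D c\<close>. Its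
  integral over a period vanishes because \<open>c\<close> is closed, so there is no mean to
  subtract, and the two length factors cancel.\<close>

lemma prim_vel_0: "vel k 0 c = D c" "prim (vel k 0 c) \<theta> = c \<theta> - c 0"
proof -
  note len = len_pos[OF c_Imm] and spd = spd_pos[OF c_Imm]
  have "(\<lambda>x. spd c x *\<^sub>R utan k 0 c x) = D c"
    using less_imp_neq[OF spd] by (auto simp: utan_def scaleR_conv_of_real)
  moreover have pD: "prim (D c) \<theta> = c \<theta> - c 0" for \<theta>
    by (rule prim_unique[OF smooth_fun_D smooth_fun_continuous_D]) (use ImmD[OF c_Imm] in auto)
  moreover have "c (2 * pi) = c 0" using ImmD(1)[OF c_Imm] unfolding periodic2pi_def by (metis add_0)
  ultimately have "cmean c (utan k 0 c) = 0" by (simp add: cmean_def)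
  then show v: "vel k 0 c = D c"
    using less_imp_neq[OF spd] len by (auto simp: vel_def utan_def scaleR_conv_of_real)
  show "prim (vel k 0 c) \<theta> = c \<theta> - c 0" by (simp add: v pD)
qed

lemma flow_0: "flow k 0 c = c"
proof
  fix \<theta>
  have "cmean c (prim (vel k 0 c)) = cmean c c - c 0"
    unfolding prim_vel_0(2)[abs_def]
    by (subst cmean_diff[OF c_Imm]) (use smooth_fun_continuous ImmD(2)[OF c_Imm] in \<open>auto simp: cmean_const[OF c_Imm]\<close>)
  then show "flow k 0 c \<theta> = c \<theta>" by (simp add: flow_def prim_vel_0(2))
qed

text \<open>At \<open>t = 1\<close> the unit tangents have mean zero, so the velocity is that of a
  round curve run through by arc length. Both curves have centre of mass 0, hence no translation
  remains.\<close>

lemma flow_1: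
  assumes k: "k \<noteq> 0"
  obtains \<alpha> where "norm \<alpha> = 1" "flow k 1 c = e_curve k \<alpha> \<circ> arclen c"
proof -
  \<comment> \<open>The constant part of \<open>utan_angle\<close> at \<open>t = 1\<close>: the
    initial angle of \<open>c\<close> plus the mean deviation.\<close>
  define \<alpha> where "\<alpha> = exp (\<i> * of_real (Im (Ln (D c 0)) + cmean c (dev k c)))"
  let ?E = "\<lambda>\<theta>. e_curve k \<alpha> (arclen c \<theta>)"
  have u: "utan k 1 c = (\<lambda>\<theta>. \<alpha> * exp (\<i> * of_int k * of_real (arclen c \<theta>)))"
    by (simp add: fun_eq_iff utan_eq_exp[OF ck] utan_angle_def[OF ck] Im_lift_log[OF ck] \<alpha>_def exp_add[symmetric] algebra_simps)
  then have v: "vel k 1 c = (\<lambda>\<theta>. (2 * pi / len c * spd c \<theta>) *\<^sub>R (\<alpha> * exp (\<i> * of_int k * of_real (arclen c \<theta>))))"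
    by (simp add: vel_def[abs_def] cmean_e_curve_arclen[OF k])
  have "(?E has_vector_derivative vel k 1 c \<theta>) (at \<theta>)" for \<theta>
    using vector_diff_chain_at[OF arclen_has_vector_derivative[OF c_Imm] e_curve_has_vector_derivative[OF k]]
    by (simp add: o_def v)
  then have W: "prim (vel k 1 c) \<theta> = ?E \<theta> - ?E 0" for \<theta>
    by (rule prim_unique) (rule continuous_vel[OF ck])
  have "continuous_on UNIV ?E"
    by (rule continuous_on_compose2[OF smooth_fun_continuous[OF smooth_e_curve]])
      (auto intro: smooth_fun_continuous smooth_arclen c_Imm)
  then have "cmean c (prim (vel k 1 c)) = - ?E 0"
    unfolding W[abs_def]
    by (subst cmean_diff[OF c_Imm]) (auto simp: cmean_const[OF c_Imm] cmean_e_curve_arclen[OF k])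
  then have "flow k 1 c = e_curve k \<alpha> \<circ> arclen c" by (simp add: fun_eq_iff flow_def W)
  moreover have "norm \<alpha> = 1" by (simp add: \<alpha>_def)
  ultimately show thesis by (rule that[rotated])
qed

section \<open>Equivariance under reparametrization\<close>

context
  fixes \<phi> :: "real \<Rightarrow> real"
  assumes \<phi>: "\<phi> \<in> Diff_plus"
begin

private lemma D_comp: "D (c \<circ> \<phi>) \<theta> = D \<phi> \<theta> *\<^sub>R D c (\<phi> \<theta>)"
  by (rule D_compose[OF ImmD(2)[OF c_Imm] Diff_plusD(1)[OF \<phi>]])

text \<open>The term at \<open>\<phi> 0\<close> appears because a lift may move 0. It is carried
  through the formulas for \<open>arclen\<close>, \<open>dev\<close> and \<open>flow\<close> until a
  mean cancels it.\<close>

lemma prim_substitution: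
  fixes f :: "real \<Rightarrow> 'a::euclidean_space"
  assumes f: "continuous_on UNIV f"
  shows "prim (\<lambda>\<theta>. D \<phi> \<theta> *\<^sub>R f (\<phi> \<theta>)) x = prim f (\<phi> x) - prim f (\<phi> 0)"
proof (rule prim_unique)
  show "((\<lambda>x. prim f (\<phi> x)) has_vector_derivative D \<phi> x *\<^sub>R f (\<phi> x)) (at x)" for x
    using vector_diff_chain_at[OF smooth_fun_D[OF Diff_plusD(1)[OF \<phi>]] prim_has_vector_derivative[OF f]]
    by (simp add: o_def)
  show "continuous_on UNIV (\<lambda>\<theta>. D \<phi> \<theta> *\<^sub>R f (\<phi> \<theta>))"
    using Diff_plusD(1)[OF \<phi>]
    by (intro continuous_intros smooth_fun_continuous_D continuous_on_compose2[OF f] smooth_fun_continuous) auto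
qed

lemma prim_substitution_2pi:
  fixes f :: "real \<Rightarrow> 'a::euclidean_space"
  assumes f: "continuous_on UNIV f" "periodic2pi f"
  shows "prim (\<lambda>\<theta>. D \<phi> \<theta> *\<^sub>R f (\<phi> \<theta>)) (2 * pi) = prim f (2 * pi)"
  using prim_periodic[OF f] by (simp add: prim_substitution[OF f(1)] Diff_plusD(6)[OF \<phi>])

lemma spd_compose: "spd (c \<circ> \<phi>) = (\<lambda>\<theta>. D \<phi> \<theta> *\<^sub>R spd c (\<phi> \<theta>))"
  using Diff_plusD(2)[OF \<phi>] by (simp add: spd_def[abs_def] D_comp abs_of_pos)

lemma len_compose: "len (c \<circ> \<phi>) = len c"
  unfolding len_def spd_compose by (rule prim_substitution_2pi[OF continuous_spd[OF c_Imm] periodic_spd[OF c_Imm]])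

lemma cmean_compose:
  fixes f :: "real \<Rightarrow> 'a::euclidean_space"
  assumes f: "continuous_on UNIV f" "periodic2pi f"
  shows "cmean (c \<circ> \<phi>) (\<lambda>\<theta>. f (\<phi> \<theta>)) = cmean c f"
  unfolding cmean_def len_compose spd_compose
  using prim_substitution_2pi[of "\<lambda>\<theta>. spd c \<theta> *\<^sub>R f \<theta>"] continuous_cmean_integrand[OF c_Imm f(1)]
    f(2) periodic_spd[OF c_Imm] by (simp add: periodic2pi_def)

lemma arclen_compose: "arclen (c \<circ> \<phi>) \<theta> = arclen c (\<phi> \<theta>) - arclen c (\<phi> 0)"
  unfolding arclen_def len_compose spd_compose prim_substitution[OF continuous_spd[OF c_Imm]]
  by (simp add: algebra_simps)

text \<open>The logarithmic derivative of the new velocity has the additional summand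
  \<open>D (D \<phi>) / D \<phi>\<close>, which is real and disappears under
  \<open>Im\<close>.\<close>

lemma dev_compose: "dev k (c \<circ> \<phi>) \<theta> = dev k c (\<phi> \<theta>) - dev k c (\<phi> 0)"
proof -
  note d = Diff_plusD[OF \<phi>] and ic = ImmD[OF c_Imm]
  let ?q = "\<lambda>x. Im (D (D c) x / D c x)"
  have "D (D (c \<circ> \<phi>)) x = D (D \<phi>) x *\<^sub>R D c (\<phi> x) + (D \<phi> x * D \<phi> x) *\<^sub>R D (D c) (\<phi> x)" for x
  proof -
    have "D (c \<circ> \<phi>) = (\<lambda>x. D \<phi> x *\<^sub>R D c (\<phi> x))" using D_comp by auto
    moreover have d2: "((\<lambda>x. D \<phi> x *\<^sub>R D c (\<phi> x)) has_vector_derivative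
        D \<phi> x *\<^sub>R (D \<phi> x *\<^sub>R D (D c) (\<phi> x)) + D (D \<phi>) x *\<^sub>R D c (\<phi> x)) (at x)" for x
      by (intro bounded_bilinear.has_vector_derivative[OF bounded_bilinear_scaleR] smooth_fun_DD d
        vector_diff_chain_at[OF smooth_fun_D[OF d(1)] smooth_fun_DD[OF ic(2)], unfolded o_def])
    ultimately show ?thesis using D_eqI[OF d2] by (simp add: add.commute)
  qed
  then have "D (D (c \<circ> \<phi>)) x / D (c \<circ> \<phi>) x =
      of_real (D (D \<phi>) x / D \<phi> x) + of_real (D \<phi> x) * (D (D c) (\<phi> x) / D c (\<phi> x))" for x
    using ic(3)[of "\<phi> x"] less_imp_neq[OF d(2), of x]
    by (simp add: D_comp scaleR_conv_of_real field_simps)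
  moreover have "Im (of_real a + of_real b * z) = b * Im z" for a b z by simp
  ultimately have "(\<lambda>x. Im (D (D (c \<circ> \<phi>)) x / D (c \<circ> \<phi>) x)) = (\<lambda>x. D \<phi> x *\<^sub>R ?q (\<phi> x))"
    by (simp only: real_scaleR_def)
  moreover have "continuous_on UNIV ?q"
    by (intro continuous_intros Imm_continuous_log_derivative c_Imm)
  ultimately have "prim (\<lambda>x. Im (D (D (c \<circ> \<phi>)) x / D (c \<circ> \<phi>) x)) \<theta> = prim ?q (\<phi> \<theta>) - prim ?q (\<phi> 0)"
    by (simp only:) (rule prim_substitution[where f = ?q])
  then show ?thesis
    by (simp add: dev_def arclen_compose algebra_simps)
qed

text \<open>The mean shifts by the same constant as \<open>dev\<close> itself, so their difference,
  the only quantity entering \<open>utan\<close>, is simply transported by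
  \<open>\<phi>\<close>.\<close>

lemma cmean_dev_compose: "cmean (c \<circ> \<phi>) (dev k (c \<circ> \<phi>)) = cmean c (dev k c) - dev k c (\<phi> 0)"
proof -
  have cd: "continuous_on UNIV (dev k c)" by (rule smooth_fun_continuous[OF smooth_dev[OF c_Imm]])
  then have "continuous_on UNIV (\<lambda>\<theta>. dev k c (\<phi> \<theta>))"
    by (rule continuous_on_compose2) (auto intro: smooth_fun_continuous Diff_plusD(1)[OF \<phi>])
  moreover have "c \<circ> \<phi> \<in> Imm" using Imm_k_Imm compose_in_Imm_k[OF ck \<phi>] by blast
  ultimately show ?thesis
    unfolding dev_compose[abs_def]
    by (subst cmean_diff)
      (auto simp: cmean_const cmean_compose[OF cd] dev_shift[OF ck] periodic2pi_def)
qed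

lemma utan_compose: "utan k t (c \<circ> \<phi>) \<theta> = utan k t c (\<phi> \<theta>)"
  using Diff_plusD(2)[OF \<phi>, of \<theta>]
  by (simp add: utan_def cmean_dev_compose dev_compose D_comp spd_compose scaleR_conv_of_real)

lemma vel_compose: "vel k t (c \<circ> \<phi>) \<theta> = D \<phi> \<theta> *\<^sub>R vel k t c (\<phi> \<theta>)"
  by (simp add: vel_def utan_compose[abs_def] cmean_compose[OF continuous_utan[OF ck] periodic_utan[OF ck]]
      len_compose spd_compose utan_compose algebra_simps)

text \<open>The base point term of the primitive is constant, so subtracting the mean removes it.
  The centre of mass in the last summand is invariant.\<close>

lemma flow_compose: "flow k t (c \<circ> \<phi>) = flow k t c \<circ> \<phi>"
proof
  fix \<theta>
  let ?W = "prim (vel k t c)"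
  have cW: "continuous_on UNIV ?W" by (rule continuous_on_prim[OF continuous_vel[OF ck]])
  have pW: "periodic2pi ?W" using periodic_flow[OF ck] by (simp add: periodic2pi_def flow_def)
  have W: "prim (vel k t (c \<circ> \<phi>)) \<theta> = ?W (\<phi> \<theta>) - ?W (\<phi> 0)" for \<theta>
    using prim_substitution[OF continuous_vel[OF ck]] by (simp add: vel_compose[abs_def])
  have "continuous_on UNIV (\<lambda>\<theta>. ?W (\<phi> \<theta>))"
    by (rule continuous_on_compose2[OF cW]) (auto intro: smooth_fun_continuous Diff_plusD(1)[OF \<phi>])
  moreover have i: "c \<circ> \<phi> \<in> Imm" using Imm_k_Imm compose_in_Imm_k[OF ck \<phi>] by blast
  ultimately have "cmean (c \<circ> \<phi>) (prim (vel k t (c \<circ> \<phi>))) = cmean c ?W - ?W (\<phi> 0)"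
    unfolding W[abs_def]
    by (subst cmean_diff) (auto simp: cmean_const[OF i] cmean_compose[OF cW pW])
  moreover have "cmean (c \<circ> \<phi>) (c \<circ> \<phi>) = cmean c c"
    using cmean_compose[OF smooth_fun_continuous[OF ImmD(2)[OF c_Imm]] ImmD(1)[OF c_Imm]] by (simp add: o_def)
  ultimately show "flow k t (c \<circ> \<phi>) \<theta> = (flow k t c \<circ> \<phi>) \<theta>"
    by (simp add: flow_def W)
qed

end
end

text \<open>On a round curve \<open>dev\<close> vanishes, the length is 2 pi so that the scalar in
  \<open>vel\<close> is 1, and the centre of mass is 0. Hence nothing in the formula varies with
  \<open>t\<close>, and \<open>flow_0\<close> applies.\<close>

lemma flow_e_circle:
  assumes k: "k \<noteq> 0" and a: "a \<in> e_circle k"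
  shows "flow k t a = a"
proof -
  obtain \<alpha> where \<alpha>: "norm \<alpha> = 1" "a = e_curve k \<alpha>" using a by (auto simp: e_circle_def)
  have ak: "a \<in> Imm_k k" using e_curve_in_Imm_k[OF k] \<alpha> by simp
  note spd = spd_e_curve[OF k \<alpha>(1), folded \<alpha>(2)]
  have len: "len a = 2 * pi" by (simp add: len_def spd prim_const)
  have arclen: "arclen a = (\<lambda>x. x)" by (simp add: arclen_def[abs_def] spd prim_const len)
  have "D (D a) x / D a x = \<i> * of_int k" for x
  proof -
    have "((\<lambda>z. \<alpha> * exp (\<i> * of_int k * z)) has_field_derivative
        \<i> * of_int k * (\<alpha> * exp (\<i> * of_int k * of_real x))) (at (of_real x))" for x :: real
      by (auto intro!: derivative_eq_intros)
    from D_eqI[OF has_vector_derivative_real_field[OF this]]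
    have "D (\<lambda>x. \<alpha> * exp (\<i> * of_int k * of_real x)) = (\<lambda>x. \<i> * of_int k * (\<alpha> * exp (\<i> * of_int k * of_real x)))"
      by simp
    then show ?thesis using \<alpha> by (auto simp: D_e_curve[OF k])
  qed
  then have dev: "dev k a = (\<lambda>_. 0)" by (simp add: dev_def[abs_def] arclen prim_const)
  then have u: "utan k t a = utan k 0 a"
    using cmean_const[OF Imm_k_Imm[OF ak], of "0 :: real"] by (simp add: utan_def[abs_def])
  have v: "vel k t a = vel k 0 a" by (simp add: vel_def[abs_def] u len)
  have "cmean a a = 0" using cmean_e_curve_arclen(2)[OF ak k, of \<alpha>, folded \<alpha>(2)] by (simp only: arclen)
  then have "flow k t a = flow k 0 a" by (simp add: flow_def[abs_def] v)
  then show ?thesis by (simp add: flow_0[OF ak])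
qed

section \<open>The retractions and the contraction\<close>

lemma smooth_fam_arclen_inv:
  assumes "smooth_fam P T" "\<And>p s. p \<in> topspace P \<Longrightarrow> T p s \<in> Imm"
  shows "smooth_fam P (\<lambda>p s. inv (arclen (T p s)))"
proof (rule smooth_fam_inverse_fun[OF smooth_fam_arclen[OF assms]])
  fix p s y
  assume "p \<in> topspace P"
  then have "arclen (T p s) \<in> Diff_plus" by (intro arclen_Diff_plus assms)
  from Diff_plusD[OF this] Diff_plus_inv(2)[OF this]
  show "D (arclen (T p s)) y > 0" "strict_mono (arclen (T p s))" "arclen (T p s) (inv (arclen (T p s)) y) = y"
    by auto
qed

lemma arclen_reparam_in_Imm_a:
  assumes ck: "c \<in> Imm_k k"
  shows "c \<circ> inv (arclen c) \<in> Imm_a k"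
proof -
  note c = Imm_k_Imm[OF ck]
  note a = Diff_plus_inv[OF arclen_Diff_plus[OF c]]
  have "norm (D (c \<circ> inv (arclen c)) y) = len c / (2 * pi)" for y
  proof -
    have "norm (D (c \<circ> inv (arclen c)) y) = D (inv (arclen c)) y * spd c (inv (arclen c) y)"
      using Diff_plusD(2)[OF a(1)] by (simp add: D_compose ImmD[OF c] Diff_plusD[OF a(1)] spd_def abs_of_pos)
    also have "\<dots> = len c / (2 * pi)"
      using a(4)[of y] len_pos[OF c] by (simp add: D_arclen[OF c] field_simps)
    finally show ?thesis .
  qed
  then show ?thesis using compose_in_Imm_k[OF ck a(1)] by (auto simp: Imm_a_def)
qed

lemma inv_identity: "inv (\<lambda>x. x) = (\<lambda>x. x)"
  using inv_id by (simp add: id_def)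

lemma smooth_curve_in_fam:
  assumes "smooth_curve_in X F" "X \<subseteq> Imm"
  shows "smooth_fam pt (\<lambda>_. F)" "F s \<in> Imm"
  using assms by (auto simp: smooth_curve_in_def smooth2_iff_smooth_fam)

text \<open>A function of \<open>s\<close> is the same function of \<open>\<theta>\<close>
  reparametrized by the family \<open>s\<close>.\<close>

lemma smooth_fam_of_smooth_fun: "smooth_fun t \<Longrightarrow> smooth_fam P (\<lambda>p s \<theta>. t s)"
  by (rule smooth_fam_reparam[OF smooth_fun_imp_smooth_fam smooth_fam_s])

text \<open>The interpolated reparametrization is the identity for every \<open>t\<close> once
  \<open>arclen c\<close> is, which makes the retraction strong.\<close>

lemma smooth_sdr_Imm_a: "smooth_sdr (Imm_a k) (Imm_k k)"
proof -
  define H :: "real \<Rightarrow> (real \<Rightarrow> complex) \<Rightarrow> (real \<Rightarrow> complex)"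
    where "H t c = c \<circ> (\<lambda>x. (1 - t) * x + t * inv (arclen c) x)" for t c
  have "smooth_homotopy (Imm_k k) H"
    unfolding smooth_homotopy_def
  proof (intro allI impI, elim conjE)
    fix t :: "real \<Rightarrow> real" and F
    assume t: "smooth_fun t" and F: "smooth_curve_in (Imm_k k) F"
    have "Imm_k k \<subseteq> Imm" using Imm_k_Imm by blast
    note F' = smooth_curve_in_fam[OF F this]
    have "smooth_fam pt (\<lambda>p s \<theta>. F s ((1 - t s) * \<theta> + t s * inv (arclen (F s)) \<theta>))"
      by (intro smooth_fam_reparam[OF F'(1)] smooth_fam_add smooth_fam_mult smooth_fam_diff smooth_fam_const
        smooth_fam_theta smooth_fam_of_smooth_fun t smooth_fam_arclen_inv[OF F'(1)] F'(2))
    then show "smooth2 (\<lambda>s. H (t s) (F s))"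
      by (simp add: smooth2_iff_smooth_fam H_def o_def)
  qed
  moreover have "H t c \<in> Imm_k k" if "t \<in> {0..1}" "c \<in> Imm_k k" for t c
    using that unfolding H_def
    by (intro compose_in_Imm_k Diff_plus_convex id_Diff_plus Diff_plus_inv(1) arclen_Diff_plus Imm_k_Imm)
  moreover have "H 0 c = c" for c by (simp add: H_def o_def)
  moreover have "H 1 c \<in> Imm_a k" if "c \<in> Imm_k k" for c
    using arclen_reparam_in_Imm_a[OF that] by (simp add: H_def o_def)
  moreover have "H t c = c" if "c \<in> Imm_a k" for t c
    by (simp add: H_def o_def constant_speed(1)[OF that] inv_identity algebra_simps)
  moreover have "Imm_a k \<subseteq> Imm_k k" by (auto simp: Imm_a_def)
  ultimately show ?thesis unfolding smooth_sdr_def by blast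
qed

text \<open>Along the flow the speed is proportional to |u - m| and so need not be constant;
  reparametrizing by the inverse arc length of the flowed curve returns to \<open>Imm_a k\<close>,
  and it changes nothing at \<open>t = 0\<close> or on the circle.\<close>

lemma smooth_sdr_e_circle:
  assumes k: "k \<noteq> 0"
  shows "smooth_sdr (e_circle k) (Imm_a k)"
proof -
  define H :: "real \<Rightarrow> (real \<Rightarrow> complex) \<Rightarrow> (real \<Rightarrow> complex)"
    where "H t c = flow k t c \<circ> inv (arclen (flow k t c))" for t c
  have a: "c \<in> Imm_k k" "arclen c = (\<lambda>x. x)" if "c \<in> Imm_a k" for c
    using constant_speed[OF that] by auto
  have "smooth_homotopy (Imm_a k) H"
    unfolding smooth_homotopy_def
  proof (intro allI impI, elim conjE)
    fix t :: "real \<Rightarrow> real" and F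
    assume t: "smooth_fun t" and t01: "\<forall>s. t s \<in> {0..1}" and F: "smooth_curve_in (Imm_a k) F"
    have "Imm_a k \<subseteq> Imm" using Imm_k_Imm a by blast
    note F' = smooth_curve_in_fam[OF F this]
    have FK: "F s \<in> Imm_k k" for s using F a(1) by (auto simp: smooth_curve_in_def)
    have fl: "smooth_fam pt (\<lambda>p s. flow k (t s) (F s))"
      by (rule smooth_fam_flow[OF F'(1) _ smooth_fam_of_smooth_fun[OF t]]) (rule F'(2))
    have im: "flow k (t s) (F s) \<in> Imm" for s
      using flow_in_Imm_k[OF FK k] t01 Imm_k_Imm by blast
    have "smooth_fam pt (\<lambda>p s \<theta>. flow k (t s) (F s) (inv (arclen (flow k (t s) (F s))) \<theta>))"
      by (intro smooth_fam_reparam[OF fl] smooth_fam_arclen_inv[OF fl] im)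
    then show "smooth2 (\<lambda>s. H (t s) (F s))"
      by (simp add: smooth2_iff_smooth_fam H_def o_def)
  qed
  moreover have "H t c \<in> Imm_a k" if "t \<in> {0..1}" "c \<in> Imm_a k" for t c
    unfolding H_def using that k by (intro arclen_reparam_in_Imm_a flow_in_Imm_k a)
  moreover have "H 0 c = c" if "c \<in> Imm_a k" for c
    by (simp add: H_def flow_0[OF a(1)[OF that]] a(2)[OF that] inv_identity o_def)
  moreover have e: "H t c = c" if "c \<in> e_circle k" for t c
    using a(2)[OF subsetD[OF e_circle_subset_Imm_a[OF k] that]]
    by (simp add: H_def flow_e_circle[OF k that] inv_identity o_def)
  moreover have "H 1 c \<in> e_circle k" if c: "c \<in> Imm_a k" for c
  proof -
    obtain \<alpha> where "norm \<alpha> = 1" "flow k 1 c = e_curve k \<alpha> \<circ> arclen c"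
      using flow_1[OF a(1)[OF c] k] by blast
    then have f1: "flow k 1 c \<in> e_circle k" by (auto simp: a(2)[OF c] o_def e_circle_def)
    have "H 1 c = flow k 1 c"
      using a(2)[OF subsetD[OF e_circle_subset_Imm_a[OF k] f1]] by (simp add: H_def inv_identity o_def)
    then show ?thesis using f1 by simp
  qed
  ultimately show ?thesis
    unfolding smooth_sdr_def using e_circle_subset_Imm_a[OF k] by blast
qed

section \<open>Orbits and the quotient space\<close>

lemma orbit_refl: "c \<in> orbit c"
  unfolding orbit_def using id_Diff_plus by (auto intro!: exI[of _ "\<lambda>x. x"] simp: o_def)

lemma orbit_compose:
  assumes \<phi>: "\<phi> \<in> Diff_plus"
  shows "orbit (c \<circ> \<phi>) = orbit c"
proof (intro set_eqI iffI)
  fix d assume "d \<in> orbit (c \<circ> \<phi>)"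
  then obtain \<psi> where "\<psi> \<in> Diff_plus" "d = c \<circ> (\<phi> \<circ> \<psi>)" by (auto simp: orbit_def o_assoc)
  then show "d \<in> orbit c" using compose_Diff_plus[OF \<phi>] by (auto simp: orbit_def)
next
  fix d assume "d \<in> orbit c"
  then obtain \<psi> where \<psi>: "\<psi> \<in> Diff_plus" "d = c \<circ> \<psi>" by (auto simp: orbit_def)
  then have "d = (c \<circ> \<phi>) \<circ> (inv \<phi> \<circ> \<psi>)" by (auto simp: Diff_plus_inv[OF \<phi>])
  then show "d \<in> orbit (c \<circ> \<phi>)"
    using compose_Diff_plus[OF Diff_plus_inv(1)[OF \<phi>] \<psi>(1)] unfolding orbit_def by blast
qed

lemma topspace_B_top: "topspace (B_top k) = B_k k"
proof (rule antisym)
  have "B_open k (topspace (B_top k))" by (metis openin_B_top openin_topspace)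
  then show "topspace (B_top k) \<subseteq> B_k k" by (simp add: B_open_def)
  have "{c \<in> Imm_k k. orbit c \<in> B_k k} = topspace (imm_top k)" by (auto simp: B_k_def)
  then have "openin (B_top k) (B_k k)"
    unfolding openin_B_top B_open_def by (metis openin_topspace order_refl)
  then show "B_k k \<subseteq> topspace (B_top k)" by (rule openin_subset)
qed

lemma quotient_map_orbit: "quotient_map (imm_top k) (B_top k) orbit"
  by (auto simp: quotient_map_def topspace_B_top openin_B_top B_open_def B_k_def)

text \<open>Rotating a round curve by \<open>\<alpha>\<close> amounts to shifting its parameter by
  the argument of \<open>\<alpha>\<close> divided by \<open>k\<close>, and shifts lie in
  \<open>Diff_plus\<close>.\<close>

lemma orbit_e_curve:
  assumes "k \<noteq> 0" "norm \<alpha> = 1"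
  shows "orbit (e_curve k \<alpha>) = orbit (e_curve k 1)"
proof -
  define b where "b = Im (Ln \<alpha>) / of_int k"
  have "\<alpha> = exp (Ln \<alpha>)" using assms(2) by (metis exp_Ln norm_zero zero_neq_one)
  moreover have "Re (Ln \<alpha>) = 0" using assms(2) by (metis Re_Ln ln_one norm_zero zero_neq_one)
  ultimately have \<alpha>: "\<alpha> = exp (\<i> * of_int k * of_real b)"
    using assms(1) by (simp add: b_def complex_eq_iff Re_exp Im_exp)
  have D: "D (\<lambda>x. x + b) = (\<lambda>_. 1)"
    by (rule D_eqI) (auto intro!: derivative_eq_intros)
  have "smooth_fun (\<lambda>x. x + b)"
    unfolding smooth_fun_iff_smooth_fam by (intro smooth_fam_add smooth_fam_theta smooth_fam_const)
  then have "(\<lambda>x. x + b) \<in> Diff_plus" by (simp add: Diff_plus_def D)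
  moreover have "e_curve k \<alpha> = e_curve k 1 \<circ> (\<lambda>x. x + b)"
    by (auto simp: e_curve_def \<alpha> exp_add[symmetric] algebra_simps)
  ultimately show ?thesis by (simp add: orbit_compose)
qed

lemma contractible_B_top:
  assumes k: "k \<noteq> 0"
  shows "contractible_space (B_top k)"
proof -
  let ?I = "top_of_set {0..1 :: real}"
  let ?P = "prod_topology ?I (imm_top k)"
  \<comment> \<open>A representative of the orbit is chosen arbitrarily; by
    \<open>flow_compose\<close> and \<open>orbit_compose\<close> the result does not depend on
    it.\<close>
  define h where "h = (\<lambda>(t, X). orbit (flow k t (SOME c. c \<in> X)))"
  have h: "h (t, orbit c) = orbit (flow k t c)" if c: "c \<in> Imm_k k" for t c
  proof -
    have "(SOME b. b \<in> orbit c) \<in> orbit c" 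
      by (rule someI[where P = "\<lambda>b. b \<in> orbit c", OF orbit_refl])
    then obtain \<phi> where \<phi>: "\<phi> \<in> Diff_plus" "(SOME b. b \<in> orbit c) = c \<circ> \<phi>" by (auto simp: orbit_def)
    then show ?thesis by (simp add: h_def flow_compose[OF c] orbit_compose)
  qed
  have I: "p \<in> topspace ?P \<Longrightarrow> fst p \<in> {0..1} \<and> snd p \<in> Imm_k k" for p by auto
  have sm: "smooth_fam ?P (\<lambda>p s. flow k (fst p) (snd p))"
  proof (rule smooth_fam_flow)
    show "smooth_fam ?P (\<lambda>p s. snd p)"
      by (rule smooth_fam_pullback[OF continuous_map_snd smooth_fam_imm_top])
    show "smooth_fam ?P (\<lambda>p s \<theta>. fst p)"
      using continuous_map_into_fulltopology[OF continuous_map_fst] by (intro smooth_fam_param)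
  qed (use I Imm_k_Imm in blast)
  have "continuous_map ?P (imm_top k) (\<lambda>p. flow k (fst p) (snd p))"
    by (rule continuous_map_into_imm_top[OF sm]) (use I flow_in_Imm_k k in blast)
  from continuous_map_compose[OF this quotient_imp_continuous_map[OF quotient_map_orbit]]
  have "continuous_map ?P (B_top k) (h \<circ> (\<lambda>(t, c). (t, orbit c)))"
    by (rule continuous_map_eq) (auto simp: h)
  \<comment> \<open>Continuity of \<open>h\<close> can be tested upstairs only if the product map is
    itself a quotient map; local compactness of the time interval guarantees this.\<close>
  moreover have "quotient_map ?P (prod_topology ?I (B_top k)) (\<lambda>(t, c). (t, orbit c))"
  proof (rule quotient_map_prod_right[OF _ disjI1 quotient_map_orbit])
    show "locally_compact_space ?I"
      by (rule compact_imp_locally_compact_space[OF compact_space_subtopology]) simp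
    show "Hausdorff_space ?I" by (rule Hausdorff_space_subtopology[OF Hausdorff_space_euclidean])
  qed
  ultimately have "continuous_map (prod_topology ?I (B_top k)) (B_top k) h"
    by (rule continuous_compose_quotient_map[rotated])
  moreover have "h (0, X) = X" "h (1, X) = orbit (e_curve k 1)" if X: "X \<in> B_k k" for X
  proof -
    obtain c where c: "c \<in> Imm_k k" "X = orbit c" using X by (auto simp: B_k_def)
    show "h (0, X) = X" by (simp add: c h flow_0)
    obtain \<alpha> where \<alpha>: "norm \<alpha> = 1" "flow k 1 c = e_curve k \<alpha> \<circ> arclen c"
      using flow_1[OF c(1) k] by blast
    have "h (1, X) = orbit (e_curve k \<alpha>)"
      by (simp add: c(2) h[OF c(1)] \<alpha>(2) orbit_compose[OF arclen_Diff_plus[OF Imm_k_Imm[OF c(1)]]])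
    then show "h (1, X) = orbit (e_curve k 1)"
      by (simp only: orbit_e_curve[OF k \<alpha>(1)])
  qed
  ultimately have "homotopic_with (\<lambda>x. True) (B_top k) (B_top k) id (\<lambda>x. orbit (e_curve k 1))"
    by (subst homotopic_with) (auto simp: topspace_B_top intro!: exI[of _ h])
  then show ?thesis unfolding contractible_space_def by blast
qed

theorem theorem2p10:
  fixes k :: int
  shows "smooth_sdr (Imm_a k) (Imm_k k) \<and>
         (k \<noteq> 0 \<longrightarrow> smooth_sdr (e_circle k) (Imm_a k) \<and> contractible_space (B_top k))"
  using smooth_sdr_Imm_a smooth_sdr_e_circle contractible_B_top by blast

end
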